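(* For every compact set $K\subset\mathsf{Z}$, $$\lim_{n\to\infty}\ \sup_{z\in K}|J_n^*(z)-J^*(z)|=0 .$$ Therefore, $\lim_{n\to\infty}|J_n^*(z)-J^*(z)|=0$ for all $z\in\mathsf{Z}$.
   Context: Setting. $\mathsf{Z}$ (state space) and $\mathsf{A}$ (action space) are Borel spaces (Borel subsets of complete separable metric spaces); $d_{\mathsf{A}}$ is the metric on $\mathsf{A}$. $\eta(\cdot|z,a)$ is a stochastic kernel on $\mathsf{Z}$ given $\mathsf{Z}\times\mathsf{A}$ (the transition probability), $c:\mathsf{Z}\times\mathsf{A}\to[0,\infty)$ is a measurable one-stage cost, and $\beta\in(0,1)$ is a discount factor. Every action in $\mathsf{A}$ is admissible in every state. Policies and cost. Let $\mathsf{H}_0=\mathsf{Z}$ and $\mathsf{H}_t=(\mathsf{Z}\times\mathsf{A})^t\times\mathsf{Z}$ for $t\ge1$. A policy is a sequence $\varphi=\{\varphi_t\}_{t\ge0}$ of stochastic kernels $\varphi_t$ on $\mathsf{A}$ given $\mathsf{H}_t$; $\Phi$ is the set of all policies. A policy $\varphi$ and an initial state $z$ determine (Ionescu Tulcea) a probability measure on $(\mathsf{Z}\times\mathsf{A})^\infty$, with expectation $E_z^\varphi$, under which $z_0=z$, $a_t\sim\varphi_t(\cdot|z_0,a_0,\dots,z_t)$ and $z_{t+1}\sim\eta(\cdot|z_t,a_t)$. The discounted cost is $J(\varphi,z)=E_z^\varphi\big[\sum_{t=0}^\infty\beta^t c(z_t,a_t)\big]$ and the discounted value function is $J^*(z)=\inf_{\varphi\in\Phi}J(\varphi,z)$.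 Standing assumptions. (a) $c$ is nonnegative and continuous. (b) $\eta$ is weakly continuous: if $(z_k,a_k)\to(z,a)$ then $\eta(\cdot|z_k,a_k)\to\eta(\cdot|z,a)$ weakly. (c) $\mathsf{A}$ is compact. (d) There exist nonnegative real numbers $M$ and $\alpha\in[1,1/\beta)$ and a continuous function $w:\mathsf{Z}\to[1,\infty)$ such that for each $z\in\mathsf{Z}$, $\sup_{a\in\mathsf{A}}c(z,a)\le Mw(z)$ and $\sup_{a\in\mathsf{A}}\int_{\mathsf{Z}}w(y)\,\eta(dy|z,a)\le\alpha w(z)$, and $\int_{\mathsf{Z}}w(y)\,\eta(dy|z,a)$ is continuous in $(z,a)$. Quantized model. For each $n\ge1$ a finite set $\Lambda_n=\{a_{n,1},\dots,a_{n,k_n}\}\subset\mathsf{A}$ is fixed with $\min_{i}d_{\mathsf{A}}(a,a_{n,i})<1/n$ for all $a\in\mathsf{A}$. MDP$_n$ is the Markov decision process with state space $\mathsf{Z}$, action space $\Lambda_n$, transition probability $\eta$ and cost $c$ (both restricted to $\mathsf{Z}\times\Lambda_n$), and $J_n^*$ is its discounted value function (the infimum of the discounted cost over all policies of MDP$_n$). Let $C_w(\mathsf{Z})$ be the space of continuous $u:\mathsf{Z}\to\mathbb{R}$ with $\|u\|_w:=\sup_{z}|u(z)|/w(z)<\infty$. It is known that, under the assumptions above, $J^*$ is the unique fixed point in $C_w(\mathsf{Z})$ of $Tu(z)=\min_{a\in\mathsf{A}}\big[c(z,a)+\beta\int_{\mathsf{Z}}u(y)\,\eta(dy|z,a)\big]$,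 and $J_n^*$ is the unique fixed point in $C_w(\mathsf{Z})$ of $T_nu(z)=\min_{a\in\Lambda_n}\big[c(z,a)+\beta\int_{\mathsf{Z}}u(y)\,\eta(dy|z,a)\big]$. *)

theory Defs
  imports "HOL-Probability.Probability"
begin

text \<open>A Borel space is a Borel subset of a complete separable metric space (class
  \<open>polish_space\<close>), with the trace sigma-algebra.\<close>

abbreviation borel_on :: "'a::topological_space set \<Rightarrow> 'a measure" where
  "borel_on X \<equiv> restrict_space borel X"

text \<open>The functions \<open>\<eta>\<close> and \<open>c\<close> are total on the types; only their values on \<open>Z \<times> A\<close> matter.
  Replacing \<open>A\<close> by a smaller action set therefore restricts them.\<close>

locale mdp =
  fixes Z :: "'z::polish_space set"
    and A :: "'a::polish_space set"
    and \<eta> :: "'z \<times> 'a \<Rightarrow> 'z measure"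
    and c :: "'z \<times> 'a \<Rightarrow> real"
    and \<beta> :: real
  assumes borel_Z: "Z \<in> sets borel"
    and borel_A: "A \<in> sets borel"
    and kernel: "\<eta> \<in> borel_on Z \<Otimes>\<^sub>M borel_on A \<rightarrow>\<^sub>M prob_algebra (borel_on Z)"
    and cost_measurable: "c \<in> borel_measurable (borel_on Z \<Otimes>\<^sub>M borel_on A)"
    and cost_nonneg: "\<And>z a. z \<in> Z \<Longrightarrow> a \<in> A \<Longrightarrow> 0 \<le> c (z, a)"
    and discount: "0 < \<beta>" "\<beta> < 1"

text \<open>\<open>history_space Z A t\<close> is \<open>(Z \<times> A)\<^sup>t \<times> Z\<close>: the pair \<open>(\<omega>, z)\<close> consists of the past
  state-action pairs \<open>\<omega> 0, \<dots>, \<omega> (t - 1)\<close> and the current state \<open>z\<close>.\<close>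

definition history_space ::
    "'z::polish_space set \<Rightarrow> 'a::polish_space set \<Rightarrow> nat \<Rightarrow> ((nat \<Rightarrow> 'z \<times> 'a) \<times> 'z) measure" where
  "history_space Z A t = PiM {0..<t} (\<lambda>_. borel_on Z \<Otimes>\<^sub>M borel_on A) \<Otimes>\<^sub>M borel_on Z"

definition policies ::
    "'z::polish_space set \<Rightarrow> 'a::polish_space set \<Rightarrow>
      (nat \<Rightarrow> (nat \<Rightarrow> 'z \<times> 'a) \<times> 'z \<Rightarrow> 'a measure) set" where
  "policies Z A = {\<phi>. \<forall>t. \<phi> t \<in> history_space Z A t \<rightarrow>\<^sub>M prob_algebra (borel_on A)}"

text \<open>Conditional law of \<open>(z\<^sub>t, a\<^sub>t)\<close> given \<open>\<omega> = (z\<^sub>0, a\<^sub>0, \<dots>, z\<^sub>t\<^sub>-\<^sub>1, a\<^sub>t\<^sub>-\<^sub>1)\<close>,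
  for the initial state \<open>z\<close>.\<close>

definition step_kernel ::
    "'z::polish_space set \<Rightarrow> 'a::polish_space set \<Rightarrow> ('z \<times> 'a \<Rightarrow> 'z measure) \<Rightarrow>
      (nat \<Rightarrow> (nat \<Rightarrow> 'z \<times> 'a) \<times> 'z \<Rightarrow> 'a measure) \<Rightarrow> 'z \<Rightarrow>
      nat \<Rightarrow> (nat \<Rightarrow> 'z \<times> 'a) \<Rightarrow> ('z \<times> 'a) measure" where
  "step_kernel Z A \<eta> \<phi> z t \<omega> =
    bind (if t = 0 then return (borel_on Z) z else \<eta> (\<omega> (t - 1)))
      (\<lambda>y. bind (\<phi> t (\<omega>, y)) (\<lambda>a. return (borel_on Z \<Otimes>\<^sub>M borel_on A) (y, a)))"

text \<open>The law on \<open>(Z \<times> A)\<^sup>\<infinity>\<close> given by the Ionescu Tulcea theorem. The library's limit measure is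
  meaningful only under the locale assumptions, which lemma \<open>Ionescu_Tulcea_step_kernel\<close>
  below establishes.\<close>

definition path_measure ::
    "'z::polish_space set \<Rightarrow> 'a::polish_space set \<Rightarrow> ('z \<times> 'a \<Rightarrow> 'z measure) \<Rightarrow>
      (nat \<Rightarrow> (nat \<Rightarrow> 'z \<times> 'a) \<times> 'z \<Rightarrow> 'a measure) \<Rightarrow> 'z \<Rightarrow> (nat \<Rightarrow> 'z \<times> 'a) measure" where
  "path_measure Z A \<eta> \<phi> z =
    (let M = (\<lambda>_. borel_on Z \<Otimes>\<^sub>M borel_on A)
     in projective_family.lim UNIV (Ionescu_Tulcea.CI (step_kernel Z A \<eta> \<phi> z) M) M)"

definition discounted_cost ::
    "'z::polish_space set \<Rightarrow> 'a::polish_space set \<Rightarrow> ('z \<times> 'a \<Rightarrow> 'z measure) \<Rightarrow>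
      ('z \<times> 'a \<Rightarrow> real) \<Rightarrow> real \<Rightarrow>
      (nat \<Rightarrow> (nat \<Rightarrow> 'z \<times> 'a) \<times> 'z \<Rightarrow> 'a measure) \<Rightarrow> 'z \<Rightarrow> ennreal" where
  "discounted_cost Z A \<eta> c \<beta> \<phi> z =
    (\<integral>\<^sup>+ \<omega>. (\<Sum>t. ennreal (\<beta> ^ t * c (\<omega> t))) \<partial>path_measure Z A \<eta> \<phi> z)"

definition value_function ::
    "'z::polish_space set \<Rightarrow> 'a::polish_space set \<Rightarrow> ('z \<times> 'a \<Rightarrow> 'z measure) \<Rightarrow>
      ('z \<times> 'a \<Rightarrow> real) \<Rightarrow> real \<Rightarrow> 'z \<Rightarrow> ennreal" where
  "value_function Z A \<eta> c \<beta> z = (INF \<phi>\<in>policies Z A. discounted_cost Z A \<eta> c \<beta> \<phi> z)"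

definition weakly_continuous_kernel ::
    "'z::polish_space set \<Rightarrow> 'a::polish_space set \<Rightarrow> ('z \<times> 'a \<Rightarrow> 'z measure) \<Rightarrow> bool" where
  "weakly_continuous_kernel Z A \<eta> \<longleftrightarrow>
    (\<forall>x p. (\<forall>k. x k \<in> Z \<times> A) \<longrightarrow> p \<in> Z \<times> A \<longrightarrow> x \<longlonglongrightarrow> p \<longrightarrow>
      (\<forall>f::'z \<Rightarrow> real. continuous_on Z f \<longrightarrow> bounded (f ` Z) \<longrightarrow>
        (\<lambda>k. \<integral>y. f y \<partial>\<eta> (x k)) \<longlonglongrightarrow> (\<integral>y. f y \<partial>\<eta> p)))"

text \<open>The distance \<open>\<bar>x - y\<bar>\<close> on \<open>[0, \<infinity>]\<close>, with value \<open>\<infinity>\<close> as soon as one argument is infinite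
  (also for \<open>x = y = \<infinity>\<close>). Being valued in \<open>ennreal\<close>, its supremum over the empty set is 0.\<close>

definition abs_diff :: "ennreal \<Rightarrow> ennreal \<Rightarrow> ennreal" where
  "abs_diff x y = e2ennreal \<bar>enn2ereal x - enn2ereal y\<bar>"

lemma abs_diff_ennreal:
  assumes "0 \<le> x" "0 \<le> y"
  shows "abs_diff (ennreal x) (ennreal y) = ennreal \<bar>x - y\<bar>"
  using assms by (simp add: abs_diff_def enn2ereal_ennreal)

lemma abs_diff_top: "abs_diff \<infinity> y = \<infinity>" "abs_diff y \<infinity> = \<infinity>"
  by (cases y; simp add: abs_diff_def enn2ereal_ennreal)+

context mdp
begin

lemma mdp_subset:
  assumes "B \<subseteq> A" "B \<in> sets borel"
  shows "mdp Z B \<eta> c \<beta>"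
proof -
  have "id \<in> borel_on B \<rightarrow>\<^sub>M borel_on A"
    using assms(1) by (intro measurable_restrict_space3) auto
  then have id: "(\<lambda>x. x) \<in> borel_on Z \<Otimes>\<^sub>M borel_on B \<rightarrow>\<^sub>M borel_on Z \<Otimes>\<^sub>M borel_on A"
    unfolding id_def
    by (intro measurable_pair) (auto simp: comp_def intro: measurable_compose[OF measurable_snd])
  show ?thesis
    using assms borel_Z kernel cost_measurable cost_nonneg discount
    by (unfold_locales) (auto intro: measurable_compose[OF id])
qed

lemma Ionescu_Tulcea_step_kernel:
  assumes \<phi>: "\<phi> \<in> policies Z A" and z: "z \<in> Z"
  shows "Ionescu_Tulcea (step_kernel Z A \<eta> \<phi> z) (\<lambda>_. borel_on Z \<Otimes>\<^sub>M borel_on A)"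
proof -
  let ?M = "\<lambda>_::nat. borel_on Z \<Otimes>\<^sub>M borel_on A"
  have \<phi>_m:
    "\<phi> t \<in> PiM {0..<t} ?M \<Otimes>\<^sub>M borel_on Z \<rightarrow>\<^sub>M prob_algebra (borel_on A)" for t
    using \<phi> by (auto simp: policies_def history_space_def)
  have state: "(\<lambda>\<omega>. if t = 0 then return (borel_on Z) z else \<eta> (\<omega> (t - 1)))
      \<in> PiM {0..<t} ?M \<rightarrow>\<^sub>M prob_algebra (borel_on Z)" for t
  proof (cases "t = 0")
    case True
    have "return (borel_on Z) z \<in> space (prob_algebra (borel_on Z))"
      using z by (auto simp: space_prob_algebra space_restrict_space intro!: prob_space_return)
    with True show ?thesis by simp
  next
    case False
    then have "(\<lambda>\<omega>. \<omega> (t - 1)) \<in> PiM {0..<t} ?M \<rightarrow>\<^sub>M borel_on Z \<Otimes>\<^sub>M borel_on A"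
      by (intro measurable_component_singleton) auto
    from measurable_compose[OF this kernel] False show ?thesis by simp
  qed
  have inner: "(\<lambda>(\<omega>, y). bind (\<phi> t (\<omega>, y)) (\<lambda>a. return (?M t) (y, a)))
      \<in> PiM {0..<t} ?M \<Otimes>\<^sub>M borel_on Z \<rightarrow>\<^sub>M prob_algebra (?M t)" for t
  proof -
    have "(\<lambda>(h, a). return (?M t) (snd h, a))
        \<in> (PiM {0..<t} ?M \<Otimes>\<^sub>M borel_on Z) \<Otimes>\<^sub>M borel_on A \<rightarrow>\<^sub>M prob_algebra (?M t)"
      unfolding case_prod_beta'
      by (rule measurable_compose[OF _ measurable_return_prob_space]) simp
    from measurable_bind_prob_space2[OF \<phi>_m this] show ?thesis
      by (simp add: case_prod_beta')
  qed
  have "step_kernel Z A \<eta> \<phi> z t \<in> PiM {0..<t} ?M \<rightarrow>\<^sub>M prob_algebra (?M t)" for t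
    unfolding step_kernel_def[abs_def]
    by (rule measurable_bind_prob_space2[OF state inner])
  note step = this
  show ?thesis
  proof (rule Ionescu_Tulcea.intro)
    show "step_kernel Z A \<eta> \<phi> z t \<in> PiM {0..<t} ?M \<rightarrow>\<^sub>M subprob_algebra (?M t)" for t
      by (rule measurable_prob_algebraD[OF step])
    show "prob_space (step_kernel Z A \<eta> \<phi> z t \<omega>)" if "\<omega> \<in> space (PiM {0..<t} ?M)" for t \<omega>
      using measurable_space[OF step that] unfolding space_prob_algebra by blast
  qed
qed

end

end

theory Submission
  imports Defs
begin

text \<open>
  Both value functions are squeezed between the same two sequences of continuous functions, and
  the squeeze is tight uniformly on compact sets. Write
  \<open>Q u (z, a) = c (z, a) + \<beta> * \<integral> u d\<eta>(\<cdot>|z, a)\<close> and \<open>C = M / (1 - \<alpha> * \<beta>)\<close>, so that \<open>0 \<le> u \<le> C * w\<close>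
  implies \<open>0 \<le> Q u \<le> C * w\<close>.

  \<^item> From below: the value iterates \<open>lower_iterate k\<close>, obtained from \<open>0\<close> by \<open>k\<close> steps of
  \<open>u \<mapsto> (INF a\<in>A. Q u (z, a))\<close>, ignore all costs from time \<open>k\<close> on and minimize the others step
  by step. They are lower bounds for the cost of every policy, with action set \<open>A\<close> or a smaller one
  (\<open>lower_iterate_le_value_function\<close>).

  \<^item> From above: start at \<open>C * w\<close> and apply \<open>k\<close> times the operator
  \<open>u \<mapsto> (INF a\<in>A. SUP b\<in>A. cutoff n (dist a b) * Q u (z, b))\<close>, where \<open>cutoff n\<close> is continuous,
  equals 1 on \<open>[0, 1/n]\<close> and vanishes beyond \<open>2/n\<close>. This gives \<open>upper_iterate n k\<close>. The supremum
  takes into account all actions within \<open>1/n\<close> of \<open>a\<close>, one of which belongs to the net; hence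
  minimizing over the net costs no more. As the net is finite, minimizers can be chosen measurably,
  and the resulting Markov policy costs at most \<open>upper_iterate n k\<close>. It is a policy for the net
  as well as for \<open>A\<close>, so both value functions are at most \<open>upper_iterate n k\<close>
  (\<open>value_function_le_upper_iterate\<close>).

  \<^item> The gap: the operators contract the weighted distance by \<open>\<alpha> * \<beta> < 1\<close>, and for fixed \<open>k\<close> the
  functions \<open>upper_iterate n k\<close> decrease in \<open>n\<close>. By induction on \<open>k\<close> their limit is at most
  \<open>lower_iterate k + C * (\<alpha> * \<beta>)^k * w\<close> (\<open>upper_iterate_near_lower_iterate\<close>). All functions are
  continuous, so the compactness argument of Dini's theorem makes this uniform on compact sets
  (\<open>upper_iterate_uniformly_near_lower_iterate\<close>). Monotonicity in \<open>n\<close> is why the cutoff is used: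
  the minima over the nets themselves need not be monotone, because the nets need not be nested.

  Continuity of the iterates rests on \<open>continuous_on_mean\<close>: integrals of unbounded functions that
  are dominated by \<open>w\<close> are continuous in \<open>(z, a)\<close>.
\<close>

section \<open>Dynamic programming inequalities for a fixed policy\<close>

locale mdp_run = mdp Z A \<eta> c \<beta>
  for Z :: "'z::polish_space set" and A :: "'a::polish_space set" and \<eta> c \<beta> +
  fixes \<phi> :: "nat \<Rightarrow> (nat \<Rightarrow> 'z \<times> 'a) \<times> 'z \<Rightarrow> 'a measure" and z :: 'z
  assumes policy: "\<phi> \<in> policies Z A" and initial_state: "z \<in> Z"
begin

abbreviation SA :: "('z \<times> 'a) measure" where "SA \<equiv> borel_on Z \<Otimes>\<^sub>M borel_on A"

sublocale IT: Ionescu_Tulcea "step_kernel Z A \<eta> \<phi> z" "\<lambda>_. SA"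
  using policy initial_state by (rule Ionescu_Tulcea_step_kernel)

abbreviation history_law :: "nat \<Rightarrow> (nat \<Rightarrow> 'z \<times> 'a) measure" where
  "history_law t \<equiv> IT.C 0 t (\<lambda>_. undefined)"

text \<open>Law of the state at time \<open>t\<close> given the past; the first of the two random choices that make up
  one step of the process.\<close>

definition state_law :: "nat \<Rightarrow> (nat \<Rightarrow> 'z \<times> 'a) \<Rightarrow> 'z measure" where
  "state_law t \<omega> = (if t = 0 then return (borel_on Z) z else \<eta> (\<omega> (t - 1)))"

definition state_expectation :: "nat \<Rightarrow> ('z \<Rightarrow> ennreal) \<Rightarrow> ennreal" where
  "state_expectation t u = (\<integral>\<^sup>+ \<omega>. (\<integral>\<^sup>+ y. u y \<partial>state_law t \<omega>) \<partial>history_law t)"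

definition cost_expectation :: "nat \<Rightarrow> ennreal" where
  "cost_expectation t = (\<integral>\<^sup>+ \<omega>. ennreal (c (\<omega> t)) \<partial>history_law (Suc t))"

lemma measurable_policy:
  "\<phi> t \<in> PiM {0..<t} (\<lambda>_. SA) \<Otimes>\<^sub>M borel_on Z \<rightarrow>\<^sub>M prob_algebra (borel_on A)"
  using policy by (auto simp: policies_def history_space_def)

lemma measurable_state_law:
  "state_law t \<in> PiM {0..<t} (\<lambda>_. SA) \<rightarrow>\<^sub>M prob_algebra (borel_on Z)"
proof (cases "t = 0")
  case True
  have "return (borel_on Z) z \<in> space (prob_algebra (borel_on Z))"
    using initial_state
    by (auto simp: space_prob_algebra space_restrict_space intro!: prob_space_return)
  with True show ?thesis by (simp add: state_law_def[abs_def])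
next
  case False
  then have "(\<lambda>\<omega>. \<omega> (t - 1)) \<in> PiM {0..<t} (\<lambda>_. SA) \<rightarrow>\<^sub>M SA"
    by (intro measurable_component_singleton) auto
  from measurable_compose[OF this kernel] False show ?thesis by (simp add: state_law_def[abs_def])
qed

lemma space_history_law: "space (history_law t) = space (PiM {0..<t} (\<lambda>_. SA))"
  using IT.space_C[of "\<lambda>_. undefined" 0 t] by (simp add: space_PiM)

lemma sets_history_law: "sets (history_law t) = sets (PiM {0..<t} (\<lambda>_. SA))"
  using IT.sets_C[of "\<lambda>_. undefined" 0 t] by (simp add: space_PiM)

lemma state_law_space:
  assumes "\<omega> \<in> space (history_law t)"
  shows "space (state_law t \<omega>) = Z" "sets (state_law t \<omega>) = sets (borel_on Z)"
proof -
  have "state_law t \<omega> \<in> space (prob_algebra (borel_on Z))"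
    using measurable_space[OF measurable_state_law] assms by (simp add: space_history_law)
  then show s: "sets (state_law t \<omega>) = sets (borel_on Z)"
    by (auto simp: space_prob_algebra)
  show "space (state_law t \<omega>) = Z"
    using sets_eq_imp_space_eq[OF s] by (simp add: space_restrict_space)
qed

lemma policy_space:
  assumes "\<omega> \<in> space (history_law t)" "y \<in> Z"
  shows "space (\<phi> t (\<omega>, y)) = A" "sets (\<phi> t (\<omega>, y)) = sets (borel_on A)"
    "prob_space (\<phi> t (\<omega>, y))"
proof -
  have "(\<omega>, y) \<in> space (PiM {0..<t} (\<lambda>_. SA) \<Otimes>\<^sub>M borel_on Z)"
    using assms by (simp add: space_history_law space_pair_measure space_restrict_space)
  from measurable_space[OF measurable_policy this]
  show s: "sets (\<phi> t (\<omega>, y)) = sets (borel_on A)" and "prob_space (\<phi> t (\<omega>, y))"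
    by (auto simp: space_prob_algebra)
  show "space (\<phi> t (\<omega>, y)) = A"
    using sets_eq_imp_space_eq[OF s] by (simp add: space_restrict_space)
qed

text \<open>One step draws the state and then the action, so its integral is an iterated one.\<close>

lemma nn_integral_step_kernel:
  assumes g: "g \<in> borel_measurable SA" and \<omega>: "\<omega> \<in> space (history_law t)"
  shows "(\<integral>\<^sup>+ x. g x \<partial>step_kernel Z A \<eta> \<phi> z t \<omega>) =
    (\<integral>\<^sup>+ y. (\<integral>\<^sup>+ a. g (y, a) \<partial>\<phi> t (\<omega>, y)) \<partial>state_law t \<omega>)"
proof -
  let ?H = "PiM {0..<t} (\<lambda>_. SA)"
  have \<omega>': "\<omega> \<in> space ?H"
    using \<omega> by (simp add: space_history_law)
  have ret: "(\<lambda>(h, a). return SA (snd h, a))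
      \<in> (?H \<Otimes>\<^sub>M borel_on Z) \<Otimes>\<^sub>M borel_on A \<rightarrow>\<^sub>M prob_algebra SA"
    unfolding case_prod_beta'
    by (rule measurable_compose[OF _ measurable_return_prob_space]) simp
  have inner: "(\<lambda>(\<omega>, y). bind (\<phi> t (\<omega>, y)) (\<lambda>a. return SA (y, a)))
      \<in> ?H \<Otimes>\<^sub>M borel_on Z \<rightarrow>\<^sub>M prob_algebra SA"
    using measurable_bind_prob_space2[OF measurable_policy ret] by (simp add: case_prod_beta')
  have "(\<lambda>y. (\<omega>, y)) \<in> borel_on Z \<rightarrow>\<^sub>M ?H \<Otimes>\<^sub>M borel_on Z"
    using \<omega>' by simp
  from measurable_compose[OF this inner]
  have inner': "(\<lambda>y. bind (\<phi> t (\<omega>, y)) (\<lambda>a. return SA (y, a)))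
      \<in> state_law t \<omega> \<rightarrow>\<^sub>M subprob_algebra SA"
    using state_law_space(2)[OF \<omega>]
    by (simp add: measurable_prob_algebraD cong: measurable_cong_sets)
  have "(\<integral>\<^sup>+ x. g x \<partial>step_kernel Z A \<eta> \<phi> z t \<omega>) =
      (\<integral>\<^sup>+ y. (\<integral>\<^sup>+ x. g x \<partial>bind (\<phi> t (\<omega>, y)) (\<lambda>a. return SA (y, a))) \<partial>state_law t \<omega>)"
    unfolding step_kernel_def state_law_def[symmetric] by (rule nn_integral_bind[OF g inner'])
  also have "\<dots> = (\<integral>\<^sup>+ y. (\<integral>\<^sup>+ a. g (y, a) \<partial>\<phi> t (\<omega>, y)) \<partial>state_law t \<omega>)"
  proof (rule nn_integral_cong)
    fix y assume "y \<in> space (state_law t \<omega>)"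
    then have y: "y \<in> Z" using state_law_space(1)[OF \<omega>] by simp
    have "(\<lambda>a. (y, a)) \<in> borel_on A \<rightarrow>\<^sub>M SA"
      using y by (intro measurable_Pair1') (simp add: space_restrict_space)
    then have m: "(\<lambda>a. return SA (y, a)) \<in> \<phi> t (\<omega>, y) \<rightarrow>\<^sub>M subprob_algebra SA"
      using policy_space(2)[OF \<omega> y] return_measurable
      by (auto intro: measurable_compose cong: measurable_cong_sets)
    have "(\<integral>\<^sup>+ x. g x \<partial>bind (\<phi> t (\<omega>, y)) (\<lambda>a. return SA (y, a))) =
        (\<integral>\<^sup>+ a. (\<integral>\<^sup>+ x. g x \<partial>return SA (y, a)) \<partial>\<phi> t (\<omega>, y))"
      by (rule nn_integral_bind[OF g m])
    also have "\<dots> = (\<integral>\<^sup>+ a. g (y, a) \<partial>\<phi> t (\<omega>, y))"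
      using y policy_space(1)[OF \<omega> y] g
      by (intro nn_integral_cong nn_integral_return)
        (auto simp: space_pair_measure space_restrict_space)
    finally show "(\<integral>\<^sup>+ x. g x \<partial>bind (\<phi> t (\<omega>, y)) (\<lambda>a. return SA (y, a))) =
        (\<integral>\<^sup>+ a. g (y, a) \<partial>\<phi> t (\<omega>, y))" .
  qed
  finally show ?thesis .
qed

lemma nn_integral_history_law_Suc:
  assumes g: "g \<in> borel_measurable SA"
  shows "(\<integral>\<^sup>+ \<omega>. g (\<omega> t) \<partial>history_law (Suc t)) =
    (\<integral>\<^sup>+ \<omega>. (\<integral>\<^sup>+ y. (\<integral>\<^sup>+ a. g (y, a) \<partial>\<phi> t (\<omega>, y)) \<partial>state_law t \<omega>) \<partial>history_law t)"
proof -
  have gt: "(\<lambda>\<omega>. g (\<omega> t)) \<in> borel_measurable (PiM {0..<Suc t} (\<lambda>_. SA))"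
    by (rule measurable_compose[OF _ g], rule measurable_component_singleton) simp
  have e: "IT.eP t \<in> history_law t \<rightarrow>\<^sub>M subprob_algebra (PiM {0..<Suc t} (\<lambda>_. SA))"
    using IT.measurable_eP[of t] sets_history_law[of t] by (simp cong: measurable_cong_sets)
  have "(\<integral>\<^sup>+ \<omega>. g (\<omega> t) \<partial>history_law (Suc t)) =
      (\<integral>\<^sup>+ \<omega>. (\<integral>\<^sup>+ \<omega>'. g (\<omega>' t) \<partial>IT.eP t \<omega>) \<partial>history_law t)"
    using nn_integral_bind[OF gt e] by simp
  also have "\<dots> = (\<integral>\<^sup>+ \<omega>. (\<integral>\<^sup>+ x. g x \<partial>step_kernel Z A \<eta> \<phi> z t \<omega>) \<partial>history_law t)"
    by (intro nn_integral_cong) (simp add: IT.nn_integral_eP[OF _ gt] space_history_law)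
  also have "\<dots> = (\<integral>\<^sup>+ \<omega>. (\<integral>\<^sup>+ y. (\<integral>\<^sup>+ a. g (y, a) \<partial>\<phi> t (\<omega>, y)) \<partial>state_law t \<omega>) \<partial>history_law t)"
    by (intro nn_integral_cong nn_integral_step_kernel[OF g])
  finally show ?thesis .
qed

lemma measurable_nn_integral_kernel:
  assumes "u \<in> borel_measurable (borel_on Z)"
  shows "(\<lambda>p. \<integral>\<^sup>+ y. u y \<partial>\<eta> p) \<in> borel_measurable SA"
  using measurable_compose[OF measurable_prob_algebraD[OF kernel]
      nn_integral_measurable_subprob_algebra[OF assms]] .

text \<open>The Markov property in the only form in which it is used below: the expected cost at time \<open>t\<close>
  plus the discounted expectation of \<open>u\<close> at the next state is an average of the one-step costs with
  continuation \<open>u\<close>. A pointwise bound on these one-step costs therefore bounds expectations under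
  any policy.\<close>

lemma cost_plus_state_expectation_Suc:
  assumes u: "u \<in> borel_measurable (borel_on Z)"
  shows "cost_expectation t + ennreal \<beta> * state_expectation (Suc t) u =
    (\<integral>\<^sup>+ \<omega>. (\<integral>\<^sup>+ y. (\<integral>\<^sup>+ a. ennreal (c (y, a)) + ennreal \<beta> * (\<integral>\<^sup>+ x. u x \<partial>\<eta> (y, a))
      \<partial>\<phi> t (\<omega>, y)) \<partial>state_law t \<omega>) \<partial>history_law t)"
proof -
  note cost_measurable[measurable]
  note measurable_nn_integral_kernel[OF u, measurable]
  have coord: "(\<lambda>\<omega>. \<omega> t) \<in> history_law (Suc t) \<rightarrow>\<^sub>M SA"
    unfolding measurable_cong_sets[OF sets_history_law refl]
    by (rule measurable_component_singleton) simp
  have m1: "(\<lambda>\<omega>. ennreal (c (\<omega> t))) \<in> borel_measurable (history_law (Suc t))"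
    by (rule measurable_compose[OF coord]) simp
  have m2: "(\<lambda>\<omega>. \<integral>\<^sup>+ x. u x \<partial>\<eta> (\<omega> t)) \<in> borel_measurable (history_law (Suc t))"
    by (rule measurable_compose[OF coord]) simp
  have m: "(\<lambda>p. ennreal (c p) + ennreal \<beta> * (\<integral>\<^sup>+ x. u x \<partial>\<eta> p)) \<in> borel_measurable SA"
    by simp
  have "cost_expectation t + ennreal \<beta> * state_expectation (Suc t) u =
      (\<integral>\<^sup>+ \<omega>. ennreal (c (\<omega> t)) + ennreal \<beta> * (\<integral>\<^sup>+ x. u x \<partial>\<eta> (\<omega> t)) \<partial>history_law (Suc t))"
    unfolding cost_expectation_def state_expectation_def state_law_def
    using m1 m2 by (simp add: nn_integral_add nn_integral_cmult del: IT.C.simps)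
  also have "\<dots> = (\<integral>\<^sup>+ \<omega>. (\<integral>\<^sup>+ y. (\<integral>\<^sup>+ a. ennreal (c (y, a)) + ennreal \<beta> * (\<integral>\<^sup>+ x. u x \<partial>\<eta> (y, a))
      \<partial>\<phi> t (\<omega>, y)) \<partial>state_law t \<omega>) \<partial>history_law t)"
    by (rule nn_integral_history_law_Suc[OF m])
  finally show ?thesis .
qed

lemma state_expectation_0:
  assumes "u \<in> borel_measurable (borel_on Z)"
  shows "state_expectation 0 u = u z"
proof -
  have "(\<integral>\<^sup>+ y. u y \<partial>return (borel_on Z) z) = u z"
    using initial_state assms by (intro nn_integral_return) (auto simp: space_restrict_space)
  moreover have "emeasure (history_law 0) (space (history_law 0)) = 1"
    by (intro prob_space.emeasure_space_1 IT.prob_space_C) (simp add: space_PiM)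
  ultimately show ?thesis
    by (simp add: state_expectation_def state_law_def del: IT.C.simps)
qed

text \<open>The cost at time \<open>t\<close> depends on finitely many coordinates only, and the projections of the
  path measure are the history laws.\<close>

lemma nn_integral_path_measure:
  assumes g: "g \<in> borel_measurable SA"
  shows "(\<integral>\<^sup>+ \<omega>. g (\<omega> t) \<partial>path_measure Z A \<eta> \<phi> z) = (\<integral>\<^sup>+ \<omega>. g (\<omega> t) \<partial>history_law (Suc t))"
proof -
  let ?J = "{0..<Suc t}" and ?M = "\<lambda>_::nat. SA"
  have gt: "(\<lambda>\<omega>. g (\<omega> t)) \<in> borel_measurable (PiM ?J ?M)"
    by (rule measurable_compose[OF _ g], rule measurable_component_singleton) simp
  have r: "(\<lambda>\<omega>. restrict \<omega> ?J) \<in> IT.PF.lim \<rightarrow>\<^sub>M PiM ?J ?M"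
    unfolding measurable_cong_sets[OF IT.PF.sets_lim refl] by (rule measurable_restrict_subset) simp
  have up: "IT.up_to ?J = Suc t"
    by (intro antisym) (auto simp: IT.up_to_iff IT.up_to_less Suc_le_eq)
  have "(\<integral>\<^sup>+ \<omega>. g (\<omega> t) \<partial>path_measure Z A \<eta> \<phi> z) =
      (\<integral>\<^sup>+ \<omega>. g (restrict \<omega> ?J t) \<partial>IT.PF.lim)"
    by (simp add: path_measure_def Let_def)
  also have "\<dots> = (\<integral>\<^sup>+ \<omega>. g (\<omega> t) \<partial>distr IT.PF.lim (PiM ?J ?M) (\<lambda>\<omega>. restrict \<omega> ?J))"
    by (rule nn_integral_distr[OF r, symmetric]) (simp add: gt)
  also have "\<dots> = (\<integral>\<^sup>+ \<omega>. g (\<omega> t) \<partial>IT.CI ?J)"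
    by (subst IT.distr_lim) auto
  also have "\<dots> = (\<integral>\<^sup>+ \<omega>. g (restrict \<omega> ?J t) \<partial>history_law (Suc t))"
    unfolding IT.CI_def up
    by (rule nn_integral_distr)
      (simp_all add: gt measurable_cong_sets[OF sets_history_law refl] measurable_restrict_subset
        del: IT.C.simps)
  finally show ?thesis by (simp del: IT.C.simps)
qed

lemma discounted_cost_eq_suminf:
  "discounted_cost Z A \<eta> c \<beta> \<phi> z = (\<Sum>t. ennreal (\<beta> ^ t) * cost_expectation t)"
proof -
  note cost_measurable[measurable]
  have coord: "(\<lambda>\<omega>. \<omega> t) \<in> path_measure Z A \<eta> \<phi> z \<rightarrow>\<^sub>M SA" for t
    unfolding path_measure_def Let_def measurable_cong_sets[OF IT.PF.sets_lim refl]
    by (rule measurable_component_singleton) simp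
  have m: "(\<lambda>\<omega>. ennreal (c (\<omega> t))) \<in> borel_measurable (path_measure Z A \<eta> \<phi> z)" for t
    by (rule measurable_compose[OF coord]) simp
  have "discounted_cost Z A \<eta> c \<beta> \<phi> z =
      (\<integral>\<^sup>+ \<omega>. (\<Sum>t. ennreal (\<beta> ^ t) * ennreal (c (\<omega> t))) \<partial>path_measure Z A \<eta> \<phi> z)"
    unfolding discounted_cost_def using discount by (simp add: ennreal_mult')
  also have "\<dots> = (\<Sum>t. ennreal (\<beta> ^ t) * (\<integral>\<^sup>+ \<omega>. ennreal (c (\<omega> t)) \<partial>path_measure Z A \<eta> \<phi> z))"
    using m by (simp add: nn_integral_suminf nn_integral_cmult)
  also have "(\<lambda>t. \<integral>\<^sup>+ \<omega>. ennreal (c (\<omega> t)) \<partial>path_measure Z A \<eta> \<phi> z) = cost_expectation"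
    unfolding cost_expectation_def
    by (rule ext, rule nn_integral_path_measure) simp
  finally show ?thesis .
qed

text \<open>If \<open>h t\<close> never exceeds the one-step cost with continuation \<open>h (Suc t)\<close>, then the expectation of
  \<open>h t\<close> is at most that of the cost at \<open>t\<close> plus the discounted \<open>h (Suc t)\<close>. These inequalities
  telescope until the horizon \<open>N\<close>, where the remainder vanishes.\<close>

lemma le_discounted_cost:
  fixes h :: "nat \<Rightarrow> 'z \<Rightarrow> ennreal"
  assumes meas: "\<And>t. h t \<in> borel_measurable (borel_on Z)"
    and sub: "\<And>t y a. y \<in> Z \<Longrightarrow> a \<in> A \<Longrightarrow>
      h t y \<le> ennreal (c (y, a)) + ennreal \<beta> * (\<integral>\<^sup>+ x. h (Suc t) x \<partial>\<eta> (y, a))"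
    and terminal: "\<And>y. h N y = 0"
  shows "h 0 z \<le> discounted_cost Z A \<eta> c \<beta> \<phi> z"
proof -
  have step: "state_expectation t (h t) \<le>
      cost_expectation t + ennreal \<beta> * state_expectation (Suc t) (h (Suc t))" for t
    unfolding cost_plus_state_expectation_Suc[OF meas] unfolding state_expectation_def
  proof (intro nn_integral_mono)
    fix \<omega> y assume \<omega>: "\<omega> \<in> space (history_law t)" and "y \<in> space (state_law t \<omega>)"
    then have y: "y \<in> Z" using state_law_space(1)[OF \<omega>] by simp
    have "h t y = (\<integral>\<^sup>+ a. h t y \<partial>\<phi> t (\<omega>, y))"
      using prob_space.emeasure_space_1[OF policy_space(3)[OF \<omega> y]] by simp
    also have "\<dots> \<le> (\<integral>\<^sup>+ a. ennreal (c (y, a)) + ennreal \<beta> * (\<integral>\<^sup>+ x. h (Suc t) x \<partial>\<eta> (y, a)) \<partial>\<phi> t (\<omega>, y))"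
      by (intro nn_integral_mono sub y) (simp add: policy_space(1)[OF \<omega> y])
    finally show "h t y \<le> (\<integral>\<^sup>+ a. ennreal (c (y, a)) + ennreal \<beta> * (\<integral>\<^sup>+ x. h (Suc t) x \<partial>\<eta> (y, a)) \<partial>\<phi> t (\<omega>, y))" .
  qed
  have "h 0 z \<le> (\<Sum>t<n. ennreal (\<beta> ^ t) * cost_expectation t)
      + ennreal (\<beta> ^ n) * state_expectation n (h n)" for n
  proof (induction n)
    case 0
    then show ?case using meas by (simp add: state_expectation_0)
  next
    case (Suc n)
    have "ennreal (\<beta> ^ n) * state_expectation n (h n) \<le>
        ennreal (\<beta> ^ n) * (cost_expectation n + ennreal \<beta> * state_expectation (Suc n) (h (Suc n)))"
      by (rule mult_left_mono[OF step]) simp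
    also have "\<dots> = ennreal (\<beta> ^ n) * cost_expectation n
        + ennreal (\<beta> ^ Suc n) * state_expectation (Suc n) (h (Suc n))"
      using discount by (simp add: distrib_left ennreal_mult' mult.assoc mult.commute mult.left_commute)
    finally show ?case
      using Suc by (simp add: add.assoc del: power_Suc) (meson add_left_mono order_trans)
  qed
  from this[of N] have "h 0 z \<le> (\<Sum>t<N. ennreal (\<beta> ^ t) * cost_expectation t)"
    by (simp add: state_expectation_def terminal)
  also have "\<dots> \<le> (\<Sum>t. ennreal (\<beta> ^ t) * cost_expectation t)"
    by (rule sum_le_suminf) auto
  finally show ?thesis by (simp add: discounted_cost_eq_suminf)
qed

text \<open>Here the inequalities telescope in the other direction; the remainder is nonnegative and can be
  dropped at every horizon.\<close>

lemma discounted_cost_le: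
  fixes h :: "nat \<Rightarrow> 'z \<Rightarrow> ennreal"
  assumes meas: "\<And>t. h t \<in> borel_measurable (borel_on Z)"
    and super: "\<And>t \<omega> y. y \<in> Z \<Longrightarrow>
      (\<integral>\<^sup>+ a. ennreal (c (y, a)) + ennreal \<beta> * (\<integral>\<^sup>+ x. h (Suc t) x \<partial>\<eta> (y, a)) \<partial>\<phi> t (\<omega>, y)) \<le> h t y"
  shows "discounted_cost Z A \<eta> c \<beta> \<phi> z \<le> h 0 z"
proof -
  have step: "cost_expectation t + ennreal \<beta> * state_expectation (Suc t) (h (Suc t))
      \<le> state_expectation t (h t)" for t
    unfolding cost_plus_state_expectation_Suc[OF meas] unfolding state_expectation_def
  proof (intro nn_integral_mono)
    fix \<omega> y assume \<omega>: "\<omega> \<in> space (history_law t)" and "y \<in> space (state_law t \<omega>)"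
    then have y: "y \<in> Z" using state_law_space(1)[OF \<omega>] by simp
    show "(\<integral>\<^sup>+ a. ennreal (c (y, a)) + ennreal \<beta> * (\<integral>\<^sup>+ x. h (Suc t) x \<partial>\<eta> (y, a)) \<partial>\<phi> t (\<omega>, y)) \<le> h t y"
      by (rule super[OF y])
  qed
  have part: "(\<Sum>t<n. ennreal (\<beta> ^ t) * cost_expectation t)
      + ennreal (\<beta> ^ n) * state_expectation n (h n) \<le> h 0 z" for n
  proof (induction n)
    case 0
    then show ?case using meas by (simp add: state_expectation_0)
  next
    case (Suc n)
    have "ennreal (\<beta> ^ n) * cost_expectation n
        + ennreal (\<beta> ^ Suc n) * state_expectation (Suc n) (h (Suc n)) =
        ennreal (\<beta> ^ n) * (cost_expectation n + ennreal \<beta> * state_expectation (Suc n) (h (Suc n)))"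
      using discount by (simp add: distrib_left ennreal_mult' mult.assoc mult.commute mult.left_commute)
    also have "\<dots> \<le> ennreal (\<beta> ^ n) * state_expectation n (h n)"
      by (rule mult_left_mono[OF step]) simp
    finally show ?case
      using Suc by (simp add: add.assoc del: power_Suc) (meson add_left_mono order_trans)
  qed
  have "(\<Sum>t. ennreal (\<beta> ^ t) * cost_expectation t) \<le> h 0 z"
  proof (rule suminf_le_const)
    show "(\<Sum>t<n. ennreal (\<beta> ^ t) * cost_expectation t) \<le> h 0 z" for n
      by (rule order_trans[OF _ part[of n]]) simp
  qed auto
  then show ?thesis by (simp add: discounted_cost_eq_suminf)
qed

end

context mdp
begin

lemma le_value_function:
  fixes h :: "nat \<Rightarrow> 'z \<Rightarrow> ennreal"
  assumes "z \<in> Z"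
    and "\<And>t. h t \<in> borel_measurable (borel_on Z)"
    and "\<And>t y a. y \<in> Z \<Longrightarrow> a \<in> A \<Longrightarrow>
      h t y \<le> ennreal (c (y, a)) + ennreal \<beta> * (\<integral>\<^sup>+ x. h (Suc t) x \<partial>\<eta> (y, a))"
    and "\<And>y. h N y = 0"
  shows "h 0 z \<le> value_function Z A \<eta> c \<beta> z"
  unfolding value_function_def
proof (rule INF_greatest)
  fix \<phi> assume "\<phi> \<in> policies Z A"
  with \<open>z \<in> Z\<close> interpret mdp_run Z A \<eta> c \<beta> \<phi> z
    by unfold_locales
  show "h 0 z \<le> discounted_cost Z A \<eta> c \<beta> \<phi> z"
    using assms by (intro le_discounted_cost) auto
qed

text \<open>Measurable selectors \<open>f t\<close> give the deterministic Markov policy that plays \<open>f t y\<close> in state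
  \<open>y\<close> at time \<open>t\<close>.\<close>

lemma value_function_le:
  fixes h :: "nat \<Rightarrow> 'z \<Rightarrow> ennreal" and f :: "nat \<Rightarrow> 'z \<Rightarrow> 'a"
  assumes "z \<in> Z"
    and meas: "\<And>t. h t \<in> borel_measurable (borel_on Z)"
    and f: "\<And>t. f t \<in> borel_on Z \<rightarrow>\<^sub>M borel_on A"
    and super: "\<And>t y. y \<in> Z \<Longrightarrow>
      ennreal (c (y, f t y)) + ennreal \<beta> * (\<integral>\<^sup>+ x. h (Suc t) x \<partial>\<eta> (y, f t y)) \<le> h t y"
  shows "value_function Z A \<eta> c \<beta> z \<le> h 0 z"
proof -
  define \<phi> :: "nat \<Rightarrow> (nat \<Rightarrow> 'z \<times> 'a) \<times> 'z \<Rightarrow> 'a measure"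
    where "\<phi> t = (\<lambda>(\<omega>, y). return (borel_on A) (f t y))" for t
  have "\<phi> \<in> policies Z A"
    unfolding policies_def history_space_def \<phi>_def case_prod_beta'
    using f by (auto intro!: measurable_compose[OF _ measurable_return_prob_space]
        intro: measurable_compose[OF measurable_snd])
  with \<open>z \<in> Z\<close> interpret mdp_run Z A \<eta> c \<beta> \<phi> z
    by unfold_locales
  have "discounted_cost Z A \<eta> c \<beta> \<phi> z \<le> h 0 z"
  proof (rule discounted_cost_le[OF meas])
    fix t \<omega> y assume y: "y \<in> Z"
    have fA: "f t y \<in> space (borel_on A)"
      using measurable_space[OF f] y by (simp add: space_restrict_space)
    note cost_measurable[measurable]
    note measurable_nn_integral_kernel[OF meas, measurable]
    have "(\<lambda>a. (y, a)) \<in> borel_on A \<rightarrow>\<^sub>M SA"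
      using y by (intro measurable_Pair1') (simp add: space_restrict_space)
    then have "(\<lambda>a. ennreal (c (y, a)) + ennreal \<beta> * (\<integral>\<^sup>+ x. h (Suc t) x \<partial>\<eta> (y, a)))
        \<in> borel_measurable (borel_on A)"
      by (rule measurable_compose[where g = "\<lambda>p. ennreal (c p) + ennreal \<beta> * (\<integral>\<^sup>+ x. h (Suc t) x \<partial>\<eta> p)"]) simp
    from nn_integral_return[OF fA this] super[OF y]
    show "(\<integral>\<^sup>+ a. ennreal (c (y, a)) + ennreal \<beta> * (\<integral>\<^sup>+ x. h (Suc t) x \<partial>\<eta> (y, a)) \<partial>\<phi> t (\<omega>, y)) \<le> h t y"
      by (simp add: \<phi>_def)
  qed
  then show ?thesis
    unfolding value_function_def using \<open>\<phi> \<in> policies Z A\<close> by (rule INF_lower2[rotated])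
qed

end

section \<open>Extrema over compact and finite sets\<close>

text \<open>Continuity of \<open>F\<close> is uniform along the compact factor, and suprema of uniformly close functions
  are close.\<close>

lemma continuous_on_SUP_compact:
  fixes F :: "'x::topological_space \<times> 'y::topological_space \<Rightarrow> real"
  assumes F: "continuous_on (X \<times> Y) F" and Y: "compact Y" "Y \<noteq> {}"
  shows "continuous_on X (\<lambda>x. SUP y\<in>Y. F (x, y))"
  unfolding continuous_on_def
proof (intro ballI tendstoI)
  fix x0 and e :: real assume x0: "x0 \<in> X" and e: "0 < e"
  have bdd: "bdd_above ((\<lambda>y. F (x, y)) ` Y)" if "x \<in> X" for x
  proof -
    have "continuous_on Y (\<lambda>y. F (x, y))"
      using that by (intro continuous_on_compose2[OF F]) (auto intro!: continuous_intros)
    then show ?thesis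
      by (intro bounded_imp_bdd_above compact_imp_bounded compact_continuous_image Y(1))
  qed
  obtain X0 where X0: "x0 \<in> X0" "open X0"
    "\<forall>x\<in>X0 \<inter> X. \<forall>y\<in>Y. dist (F (x, y)) (F (x0, y)) \<le> e / 2"
    using continuous_on_prod_compactE[OF F Y(1) x0, of "e / 2"] e by auto
  have "dist (SUP y\<in>Y. F (x, y)) (SUP y\<in>Y. F (x0, y)) < e" if x: "x \<in> X0" "x \<in> X" for x
  proof -
    have d: "\<bar>F (x, y) - F (x0, y)\<bar> \<le> e / 2" if "y \<in> Y" for y
      using X0(3) x that by (auto simp: dist_real_def)
    have "(SUP y\<in>Y. F (x, y)) \<le> (SUP y\<in>Y. F (x0, y)) + e / 2"
    proof (rule cSUP_least[OF Y(2)])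
      fix y assume y: "y \<in> Y"
      show "F (x, y) \<le> (SUP y\<in>Y. F (x0, y)) + e / 2"
        using d[OF y] cSUP_upper[OF y bdd[OF x0]] by linarith
    qed
    moreover have "(SUP y\<in>Y. F (x0, y)) \<le> (SUP y\<in>Y. F (x, y)) + e / 2"
    proof (rule cSUP_least[OF Y(2)])
      fix y assume y: "y \<in> Y"
      show "F (x0, y) \<le> (SUP y\<in>Y. F (x, y)) + e / 2"
        using d[OF y] cSUP_upper[OF y bdd[OF x(2)]] by linarith
    qed
    ultimately show ?thesis using e by (auto simp: dist_real_def)
  qed
  then show "\<forall>\<^sub>F x in at x0 within X. dist (SUP y\<in>Y. F (x, y)) (SUP y\<in>Y. F (x0, y)) < e"
    using X0(1,2) by (auto simp: eventually_at_topological)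
qed

lemma continuous_on_INF_compact:
  fixes F :: "'x::topological_space \<times> 'y::topological_space \<Rightarrow> real"
  assumes "continuous_on (X \<times> Y) F" "compact Y" "Y \<noteq> {}"
  shows "continuous_on X (\<lambda>x. INF y\<in>Y. F (x, y))"
  using continuous_on_minus[OF continuous_on_SUP_compact[OF continuous_on_minus[OF assms(1)] assms(2,3)]]
  by (simp add: Inf_real_def image_image)

text \<open>The covering argument behind Dini's theorem: the sets where \<open>D n < e\<close> are open and increase
  with \<open>n\<close>, so one of them covers \<open>K\<close>.\<close>

lemma compact_decreasing_uniform_less:
  fixes D :: "nat \<Rightarrow> 'x::topological_space \<Rightarrow> real"
  assumes K: "compact K"
    and cont: "\<And>n. continuous_on K (D n)"
    and dec: "\<And>m n x. m \<le> n \<Longrightarrow> x \<in> K \<Longrightarrow> D n x \<le> D m x"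
    and less: "\<And>x. x \<in> K \<Longrightarrow> \<exists>n. D n x < e"
  shows "\<exists>N. \<forall>n\<ge>N. \<forall>x\<in>K. D n x < e"
proof -
  have "\<exists>S. open S \<and> S \<inter> K = D n -` {..<e} \<inter> K" for n
    using cont[of n] open_lessThan[of e] unfolding continuous_on_open_invariant by blast
  then obtain S where S: "\<And>n. open (S n)" "\<And>n. S n \<inter> K = D n -` {..<e} \<inter> K"
    by metis
  have cover: "K \<subseteq> (\<Union>n\<in>UNIV. S n)"
    using less S(2) by blast
  obtain I where I: "finite I" "K \<subseteq> (\<Union>n\<in>I. S n)"
    by (rule compactE_image[OF K S(1) cover]) blast
  have "D n x < e" if "n \<ge> Max (insert 0 I)" "x \<in> K" for n x
  proof -
    obtain m where m: "m \<in> I" "x \<in> S m" using I(2) \<open>x \<in> K\<close> by blast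
    then have "D m x < e" using S(2)[of m] \<open>x \<in> K\<close> by blast
    moreover have "m \<le> n" using m(1) I(1) that(1) by simp
    ultimately show ?thesis using dec[of m n x] \<open>x \<in> K\<close> by simp
  qed
  then show ?thesis by blast
qed

text \<open>Measurability of the minimum itself is part of the conclusion because the induction step
  compares a new candidate with it.\<close>

lemma finite_measurable_argmin:
  fixes g :: "'b \<Rightarrow> 'x \<Rightarrow> real"
  assumes "finite B" "B \<noteq> {}" "B \<subseteq> space L"
    and "\<And>b. b \<in> B \<Longrightarrow> g b \<in> borel_measurable N"
  shows "\<exists>f. f \<in> N \<rightarrow>\<^sub>M L \<and> (\<lambda>x. g (f x) x) \<in> borel_measurable N \<and>
    (\<forall>x. f x \<in> B \<and> (\<forall>b\<in>B. g (f x) x \<le> g b x))"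
  using assms
proof (induction B rule: finite_ne_induct)
  case (singleton b)
  then show ?case by (intro exI[of _ "\<lambda>_. b"]) auto
next
  case (insert b B)
  then have "\<exists>f. f \<in> N \<rightarrow>\<^sub>M L \<and> (\<lambda>x. g (f x) x) \<in> borel_measurable N \<and>
      (\<forall>x. f x \<in> B \<and> (\<forall>b\<in>B. g (f x) x \<le> g b x))"
    by simp
  then obtain f where f: "f \<in> N \<rightarrow>\<^sub>M L" "(\<lambda>x. g (f x) x) \<in> borel_measurable N"
    "\<And>x. f x \<in> B" "\<And>x b'. b' \<in> B \<Longrightarrow> g (f x) x \<le> g b' x"
    by blast
  have gb: "g b \<in> borel_measurable N" and b: "b \<in> space L"
    using insert.prems by auto
  let ?f = "\<lambda>x. if g b x \<le> g (f x) x then b else f x"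
  have P: "Measurable.pred N (\<lambda>x. g b x \<le> g (f x) x)"
    using gb f(2) by measurable
  have "?f \<in> N \<rightarrow>\<^sub>M L"
    using P f(1) b by (intro measurable_If) (auto simp: pred_def)
  moreover have "(\<lambda>x. g (?f x) x) = (\<lambda>x. min (g b x) (g (f x) x))"
    by (auto simp: min_def)
  then have "(\<lambda>x. g (?f x) x) \<in> borel_measurable N"
    using gb f(2) by simp
  moreover have "\<forall>x. ?f x \<in> insert b B \<and> (\<forall>b'\<in>insert b B. g (?f x) x \<le> g b' x)"
    using f(3,4) by (auto intro: order_trans[OF less_imp_le] simp: not_le)
      (meson order_trans)+
  ultimately show ?case by blast
qed

section \<open>The weighted model and its operators\<close>

locale weighted_mdp = mdp Z A \<eta> c \<beta>
  for Z :: "'z::polish_space set" and A :: "'a::polish_space set" and \<eta> c \<beta> +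
  fixes M \<alpha> :: real and w :: "'z \<Rightarrow> real"
  assumes cost_continuous: "continuous_on (Z \<times> A) c"
    and kernel_continuous: "weakly_continuous_kernel Z A \<eta>"
    and compact_A: "compact A"
    and nonempty_A: "A \<noteq> {}"
    and M_nonneg: "0 \<le> M"
    and \<alpha>_bounds: "1 \<le> \<alpha>" "\<alpha> < 1 / \<beta>"
    and w_continuous: "continuous_on Z w"
    and w_ge_1: "\<And>z. z \<in> Z \<Longrightarrow> 1 \<le> w z"
    and cost_le: "\<And>z a. z \<in> Z \<Longrightarrow> a \<in> A \<Longrightarrow> c (z, a) \<le> M * w z"
    and nn_integral_w_le: "\<And>z a. z \<in> Z \<Longrightarrow> a \<in> A \<Longrightarrow>
      (\<integral>\<^sup>+ y. ennreal (w y) \<partial>\<eta> (z, a)) \<le> ennreal (\<alpha> * w z)"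
    and w_integral_continuous:
      "continuous_on (Z \<times> A) (\<lambda>p. \<integral>\<^sup>+ y. ennreal (w y) \<partial>\<eta> p)"
begin

text \<open>The solution \<open>C\<close> of \<open>C = M + \<beta> * \<alpha> * C\<close>: with it, \<open>C * w\<close> bounds every discounted cost, and
  functions between \<open>0\<close> and \<open>C * w\<close> are preserved by all operators below.\<close>

definition cost_scale :: real where
  "cost_scale = M / (1 - \<alpha> * \<beta>)"

definition dominated :: "('z \<Rightarrow> real) \<Rightarrow> bool" where
  "dominated u \<longleftrightarrow> continuous_on Z u \<and> (\<forall>z\<in>Z. 0 \<le> u z \<and> u z \<le> cost_scale * w z)"

definition mean :: "('z \<Rightarrow> real) \<Rightarrow> 'z \<times> 'a \<Rightarrow> real" where
  "mean u p = (\<integral>y. u y \<partial>\<eta> p)"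

definition Q :: "('z \<Rightarrow> real) \<Rightarrow> 'z \<times> 'a \<Rightarrow> real" where
  "Q u p = c p + \<beta> * mean u p"

lemma \<alpha>\<beta>_bounds: "0 < \<alpha> * \<beta>" "\<alpha> * \<beta> < 1"
  using \<alpha>_bounds discount by (auto simp: field_simps)

lemma cost_scale_nonneg: "0 \<le> cost_scale"
  using M_nonneg \<alpha>\<beta>_bounds by (simp add: cost_scale_def)

lemma cost_scale_fixpoint: "M + \<beta> * (cost_scale * \<alpha>) = cost_scale"
  using \<alpha>\<beta>_bounds by (simp add: cost_scale_def field_simps)

lemma w_nonneg: "z \<in> Z \<Longrightarrow> 0 \<le> w z"
  using w_ge_1[of z] by simp

lemma kernel_space:
  assumes "p \<in> Z \<times> A"
  shows "prob_space (\<eta> p)" "sets (\<eta> p) = sets (borel_on Z)" "space (\<eta> p) = Z"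
proof -
  have "\<eta> p \<in> space (prob_algebra (borel_on Z))"
    using assms by (intro measurable_space[OF kernel]) (auto simp: space_pair_measure space_restrict_space)
  then show "prob_space (\<eta> p)" and s: "sets (\<eta> p) = sets (borel_on Z)"
    by (auto simp: space_prob_algebra)
  show "space (\<eta> p) = Z"
    using sets_eq_imp_space_eq[OF s] by (simp add: space_restrict_space)
qed

lemma continuous_on_measurable_kernel:
  fixes u :: "'z \<Rightarrow> real"
  assumes "continuous_on Z u" "p \<in> Z \<times> A"
  shows "u \<in> borel_measurable (\<eta> p)"
  using borel_measurable_continuous_on_restrict[OF assms(1)] kernel_space(2)[OF assms(2)]
  by (simp cong: measurable_cong_sets)

lemma integrable_w: "p \<in> Z \<times> A \<Longrightarrow> integrable (\<eta> p) w"
proof -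
  assume p: "p \<in> Z \<times> A"
  then obtain z a where za: "p = (z, a)" "z \<in> Z" "a \<in> A" by auto
  have "(\<integral>\<^sup>+ y. ennreal (w y) \<partial>\<eta> p) < \<infinity>"
    using nn_integral_w_le[OF za(2,3)] unfolding za(1) by (auto intro: le_less_trans)
  then show ?thesis
    using w_nonneg kernel_space(3)[OF p]
    by (intro integrableI_nonneg continuous_on_measurable_kernel[OF w_continuous p]) auto
qed

lemma nn_integral_w_eq: "p \<in> Z \<times> A \<Longrightarrow> (\<integral>\<^sup>+ y. ennreal (w y) \<partial>\<eta> p) = ennreal (mean w p)"
  unfolding mean_def using w_nonneg kernel_space(3)
  by (intro nn_integral_eq_integral integrable_w) auto

lemma mean_w_nonneg: "p \<in> Z \<times> A \<Longrightarrow> 0 \<le> mean w p"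
  unfolding mean_def using w_nonneg kernel_space(3) by (intro Bochner_Integration.integral_nonneg) auto

lemma mean_w_le: "z \<in> Z \<Longrightarrow> a \<in> A \<Longrightarrow> mean w (z, a) \<le> \<alpha> * w z"
  using nn_integral_w_le[of z a] nn_integral_w_eq[of "(z, a)"] \<alpha>_bounds w_nonneg[of z]
  by (simp add: ennreal_le_iff)

lemma continuous_on_mean_w: "continuous_on (Z \<times> A) (mean w)"
  unfolding continuous_on_def
proof
  fix p assume p: "p \<in> Z \<times> A"
  have "((\<lambda>p. \<integral>\<^sup>+ y. ennreal (w y) \<partial>\<eta> p) \<longlongrightarrow> ennreal (mean w p)) (at p within Z \<times> A)"
    using w_integral_continuous[unfolded continuous_on_def, rule_format, OF p]
    unfolding nn_integral_w_eq[OF p] .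
  then have "((\<lambda>p. enn2real (\<integral>\<^sup>+ y. ennreal (w y) \<partial>\<eta> p)) \<longlongrightarrow> mean w p) (at p within Z \<times> A)"
    by (rule tendsto_enn2real) (rule mean_w_nonneg[OF p])
  moreover have "\<forall>\<^sub>F q in at p within Z \<times> A. enn2real (\<integral>\<^sup>+ y. ennreal (w y) \<partial>\<eta> q) = mean w q"
    unfolding eventually_at_filter
    by (intro always_eventually allI impI) (simp add: nn_integral_w_eq mean_w_nonneg)
  ultimately show "(mean w \<longlongrightarrow> mean w p) (at p within Z \<times> A)"
    by (rule Lim_transform_eventually)
qed

lemma dominatedD:
  assumes "dominated u"
  shows "continuous_on Z u" "\<And>z. z \<in> Z \<Longrightarrow> 0 \<le> u z" "\<And>z. z \<in> Z \<Longrightarrow> u z \<le> cost_scale * w z"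
  using assms by (auto simp: dominated_def)

lemma dominated_zero: "dominated (\<lambda>_. 0)"
  using cost_scale_nonneg w_nonneg by (auto simp: dominated_def)

lemma dominated_cost_scale_w: "dominated (\<lambda>z. cost_scale * w z)"
  using cost_scale_nonneg w_nonneg w_continuous by (auto simp: dominated_def intro!: continuous_intros)

lemma dominated_measurable: "dominated u \<Longrightarrow> u \<in> borel_measurable (borel_on Z)"
  by (intro borel_measurable_continuous_on_restrict dominatedD(1))

lemma integrable_dominated:
  assumes u: "dominated u" and p: "p \<in> Z \<times> A"
  shows "integrable (\<eta> p) u"
proof (rule Bochner_Integration.integrable_bound)
  show "integrable (\<eta> p) (\<lambda>y. cost_scale * w y)"
    using integrable_w[OF p] by simp
  show "u \<in> borel_measurable (\<eta> p)"
    by (rule continuous_on_measurable_kernel[OF dominatedD(1)[OF u] p])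
  show "AE y in \<eta> p. norm (u y) \<le> norm (cost_scale * w y)"
  proof (rule AE_I2)
    fix y assume "y \<in> space (\<eta> p)"
    then have "y \<in> Z" using kernel_space(3)[OF p] by simp
    then show "norm (u y) \<le> norm (cost_scale * w y)"
      using dominatedD(2,3)[OF u, of y] by simp
  qed
qed

lemma mean_mono:
  assumes "dominated u" "dominated v" "p \<in> Z \<times> A" "\<And>y. y \<in> Z \<Longrightarrow> u y \<le> v y"
  shows "mean u p \<le> mean v p"
  unfolding mean_def using assms kernel_space(3)[OF assms(3)]
  by (intro integral_mono integrable_dominated) auto

lemma mean_nonneg:
  assumes "dominated u" "p \<in> Z \<times> A"
  shows "0 \<le> mean u p"
  unfolding mean_def using dominatedD(2)[OF assms(1)] kernel_space(3)[OF assms(2)]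
  by (intro Bochner_Integration.integral_nonneg) auto

lemma nn_integral_dominated:
  assumes "dominated u" "p \<in> Z \<times> A"
  shows "(\<integral>\<^sup>+ y. ennreal (u y) \<partial>\<eta> p) = ennreal (mean u p)"
  unfolding mean_def using dominatedD(2)[OF assms(1)] kernel_space(3)[OF assms(2)]
  by (intro nn_integral_eq_integral integrable_dominated assms) auto

lemma mean_truncation_tendsto:
  assumes u: "dominated u" and p: "p \<in> Z \<times> A"
  shows "(\<lambda>N. mean (\<lambda>y. min (u y) (real N)) p) \<longlonglongrightarrow> mean u p"
  unfolding mean_def
proof (rule integral_dominated_convergence[where w = u])
  show "u \<in> borel_measurable (\<eta> p)"
    by (rule continuous_on_measurable_kernel[OF dominatedD(1)[OF u] p])
  then show "(\<lambda>y. min (u y) (real N)) \<in> borel_measurable (\<eta> p)" for N by simp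
  show "integrable (\<eta> p) u" by (rule integrable_dominated[OF u p])
  show "AE y in \<eta> p. (\<lambda>N. min (u y) (real N)) \<longlonglongrightarrow> u y"
  proof (rule AE_I2, rule tendsto_eventually)
    fix y
    obtain N0 :: nat where "u y \<le> real N0" using real_arch_simple by blast
    then show "\<forall>\<^sub>F N in sequentially. min (u y) (real N) = u y"
      by (intro eventually_sequentiallyI[of N0]) (simp add: min_def)
  qed
  show "AE y in \<eta> p. norm (min (u y) (real N)) \<le> u y" for N
    using dominatedD(2)[OF u] kernel_space(3)[OF p] by (intro AE_I2) auto
qed

text \<open>Weak continuity speaks of bounded functions. Truncations of \<open>u\<close> are bounded, have integrals
  below that of \<open>u\<close>, and approximate it at \<open>p\<close>; this yields the lower half of continuity.\<close>

lemma mean_lower_semicontinuous: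
  assumes u: "dominated u" and x: "\<And>k. x k \<in> Z \<times> A" and p: "p \<in> Z \<times> A" and lim: "x \<longlonglongrightarrow> p"
    and less: "b < mean u p"
  shows "\<forall>\<^sub>F k in sequentially. b < mean u (x k)"
proof -
  obtain N where N: "b < mean (\<lambda>y. min (u y) (real N)) p"
    using order_tendstoD(1)[OF mean_truncation_tendsto[OF u p] less]
    by (auto simp: eventually_sequentially)
  let ?v = "\<lambda>y. min (u y) (real N)"
  have v: "dominated ?v"
    using dominatedD[OF u] by (auto simp: dominated_def min.coboundedI1 intro!: continuous_intros)
  have "?v ` Z \<subseteq> {0..real N}"
    using dominatedD(2)[OF u] by auto
  then have "bounded (?v ` Z)"
    by (rule bounded_subset[OF bounded_closed_interval])
  then have "(\<lambda>k. mean ?v (x k)) \<longlonglongrightarrow> mean ?v p"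
    unfolding mean_def
    using kernel_continuous dominatedD(1)[OF v] x p lim unfolding weakly_continuous_kernel_def by blast
  from order_tendstoD(1)[OF this N] show ?thesis
  proof eventually_elim
    case (elim k)
    then show ?case using mean_mono[OF v u x[of k]] by auto
  qed
qed

text \<open>The upper half of continuity is the lower half for \<open>C * w - u\<close>, because the integral of \<open>w\<close> is
  continuous by assumption.\<close>

lemma continuous_on_mean:
  assumes u: "dominated u"
  shows "continuous_on (Z \<times> A) (mean u)"
  unfolding continuous_on_sequentially
proof (intro allI ballI impI)
  fix x p assume p: "p \<in> Z \<times> A" and "(\<forall>k. x k \<in> Z \<times> A) \<and> x \<longlonglongrightarrow> p"
  then have x: "\<And>k. x k \<in> Z \<times> A" and lim: "x \<longlonglongrightarrow> p" by auto
  let ?v = "\<lambda>y. cost_scale * w y - u y"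
  have v: "dominated ?v"
    using dominatedD[OF u] w_continuous by (auto simp: dominated_def intro!: continuous_intros)
  have mv: "mean ?v q = cost_scale * mean w q - mean u q" if "q \<in> Z \<times> A" for q
    unfolding mean_def using integrable_w[OF that] integrable_dominated[OF u that] by simp
  have lw: "(\<lambda>k. mean w (x k)) \<longlonglongrightarrow> mean w p"
    using continuous_on_mean_w p x lim unfolding continuous_on_sequentially comp_def by blast
  show "(mean u \<circ> x) \<longlonglongrightarrow> mean u p"
    unfolding comp_def
  proof (rule order_tendstoI)
    fix b assume "b < mean u p"
    then show "\<forall>\<^sub>F k in sequentially. b < mean u (x k)"
      by (rule mean_lower_semicontinuous[OF u x p lim])
  next
    fix b assume b: "mean u p < b"
    define e where "e = (b - mean u p) / 2"
    have e: "0 < e" using b by (simp add: e_def)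
    have "\<forall>\<^sub>F k in sequentially. mean ?v p - e < mean ?v (x k)"
      using e by (intro mean_lower_semicontinuous[OF v x p lim]) simp
    moreover have "\<forall>\<^sub>F k in sequentially. cost_scale * mean w (x k) < cost_scale * mean w p + e"
      using e by (intro order_tendstoD(2)[OF tendsto_mult_left[OF lw]]) simp
    ultimately show "\<forall>\<^sub>F k in sequentially. mean u (x k) < b"
    proof eventually_elim
      case (elim k)
      then show ?case using mv[OF p] mv[OF x[of k]] by (simp add: e_def field_simps)
    qed
  qed
qed

lemma continuous_on_Q: "dominated u \<Longrightarrow> continuous_on (Z \<times> A) (Q u)"
  unfolding Q_def[abs_def] using cost_continuous continuous_on_mean by (intro continuous_intros)

lemma Q_mono:
  assumes "dominated u" "dominated v" "p \<in> Z \<times> A" "\<And>y. y \<in> Z \<Longrightarrow> u y \<le> v y"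
  shows "Q u p \<le> Q v p"
  using mean_mono[OF assms] discount by (simp add: Q_def)

lemma Q_nonneg: "dominated u \<Longrightarrow> p \<in> Z \<times> A \<Longrightarrow> 0 \<le> Q u p"
  using mean_nonneg[of u p] cost_nonneg discount by (cases p) (auto simp: Q_def)

lemma Q_le:
  assumes u: "dominated u" and z: "z \<in> Z" and a: "a \<in> A"
  shows "Q u (z, a) \<le> cost_scale * w z"
proof -
  have "mean u (z, a) \<le> mean (\<lambda>y. cost_scale * w y) (z, a)"
    using dominatedD(3)[OF u] z a by (intro mean_mono u dominated_cost_scale_w) auto
  also have "\<dots> = cost_scale * mean w (z, a)" by (simp add: mean_def)
  also have "\<dots> \<le> cost_scale * (\<alpha> * w z)"
    by (intro mult_left_mono mean_w_le z a cost_scale_nonneg)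
  finally have "\<beta> * mean u (z, a) \<le> \<beta> * (cost_scale * (\<alpha> * w z))"
    using discount by simp
  then have "Q u (z, a) \<le> M * w z + \<beta> * (cost_scale * (\<alpha> * w z))"
    using cost_le[OF z a] by (simp add: Q_def)
  also have "\<dots> = (M + \<beta> * (cost_scale * \<alpha>)) * w z" by (simp add: algebra_simps)
  finally show ?thesis by (simp add: cost_scale_fixpoint)
qed

text \<open>Links the real-valued operators, for which continuity is natural, with the extended nonnegative
  integrals that define costs.\<close>

lemma ennreal_Q:
  assumes u: "dominated u" and p: "p \<in> Z \<times> A"
  shows "ennreal (c p) + ennreal \<beta> * (\<integral>\<^sup>+ y. ennreal (u y) \<partial>\<eta> p) = ennreal (Q u p)"
  using mean_nonneg[OF u p] cost_nonneg discount p
  by (auto simp: Q_def nn_integral_dominated[OF u p] ennreal_mult' ennreal_plus)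

definition bellman :: "('z \<Rightarrow> real) \<Rightarrow> 'z \<Rightarrow> real" where
  "bellman u z = (INF a\<in>A. Q u (z, a))"

definition cutoff :: "nat \<Rightarrow> real \<Rightarrow> real" where
  "cutoff n d = max 0 (min 1 (2 - real n * d))"

text \<open>The worst one-step cost over actions near the intended one. The factor \<open>cutoff\<close> replaces the
  constraint \<open>dist a b \<le> 1/n\<close> in order to keep the supremum continuous in \<open>(z, a)\<close>; since \<open>Q\<close> is
  nonnegative, a factor below 1 only lowers a candidate.\<close>

definition nearby_Q :: "nat \<Rightarrow> ('z \<Rightarrow> real) \<Rightarrow> 'z \<times> 'a \<Rightarrow> real" where
  "nearby_Q n u p = (SUP b\<in>A. cutoff n (dist (snd p) b) * Q u (fst p, b))"

definition relaxed_bellman :: "nat \<Rightarrow> ('z \<Rightarrow> real) \<Rightarrow> 'z \<Rightarrow> real" where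
  "relaxed_bellman n u z = (INF a\<in>A. nearby_Q n u (z, a))"

lemma cutoff_bounds: "0 \<le> cutoff n d" "cutoff n d \<le> 1"
  by (auto simp: cutoff_def)

lemma cutoff_antimono: "m \<le> n \<Longrightarrow> 0 \<le> d \<Longrightarrow> cutoff n d \<le> cutoff m d"
  using mult_right_mono[of "real m" "real n" d] by (auto simp: cutoff_def)

lemma cutoff_eq_1: "real n * d \<le> 1 \<Longrightarrow> cutoff n d = 1"
  by (simp add: cutoff_def)

lemma cutoff_eq_0: "2 \<le> real n * d \<Longrightarrow> cutoff n d = 0"
  by (simp add: cutoff_def)

lemma cutoff_Q_le:
  assumes "dominated u" "z \<in> Z" "b \<in> A"
  shows "cutoff n d * Q u (z, b) \<le> Q u (z, b)"
  using mult_left_le_one_le[of "Q u (z, b)" "cutoff n d"] cutoff_bounds Q_nonneg[OF assms(1), of "(z, b)"] assms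
  by simp

lemma bdd_above_cutoff_Q:
  assumes u: "dominated u" and z: "z \<in> Z"
  shows "bdd_above ((\<lambda>b. cutoff n (dist a b) * Q u (z, b)) ` A)"
  by (intro bdd_aboveI2[of _ _ "cost_scale * w z"] order_trans[OF cutoff_Q_le[OF u z] Q_le[OF u z]])

lemma cutoff_Q_le_nearby_Q:
  assumes "dominated u" "z \<in> Z" "b \<in> A"
  shows "cutoff n (dist a b) * Q u (z, b) \<le> nearby_Q n u (z, a)"
  unfolding nearby_Q_def fst_conv snd_conv
  by (rule cSUP_upper[OF assms(3) bdd_above_cutoff_Q[OF assms(1,2)]])

lemma Q_le_nearby_Q:
  assumes "dominated u" "z \<in> Z" "b \<in> A" "real n * dist a b \<le> 1"
  shows "Q u (z, b) \<le> nearby_Q n u (z, a)"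
  using cutoff_Q_le_nearby_Q[OF assms(1-3), of n a] cutoff_eq_1[OF assms(4)] by simp

lemma nearby_Q_le:
  assumes "dominated u" "z \<in> Z"
  shows "nearby_Q n u (z, a) \<le> cost_scale * w z"
  unfolding nearby_Q_def fst_conv snd_conv
  using cutoff_Q_le[OF assms] Q_le[OF assms] by (intro cSUP_least nonempty_A) (blast intro: order_trans)

lemma nearby_Q_mono:
  assumes u: "dominated u" and v: "dominated v" and z: "z \<in> Z" and mn: "m \<le> n"
    and le: "\<And>y. y \<in> Z \<Longrightarrow> u y \<le> v y"
  shows "nearby_Q n u (z, a) \<le> nearby_Q m v (z, a)"
proof -
  have "cutoff n (dist a b) * Q u (z, b) \<le> nearby_Q m v (z, a)" if b: "b \<in> A" for b
  proof -
    have "cutoff n (dist a b) * Q u (z, b) \<le> cutoff m (dist a b) * Q v (z, b)"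
      using z b by (intro mult_mono cutoff_antimono mn Q_mono u v le cutoff_bounds Q_nonneg) auto
    also have "\<dots> \<le> nearby_Q m v (z, a)" by (rule cutoff_Q_le_nearby_Q[OF v z b])
    finally show ?thesis .
  qed
  then show ?thesis
    unfolding nearby_Q_def[of n] fst_conv snd_conv by (intro cSUP_least nonempty_A)
qed

lemma continuous_on_nearby_Q:
  assumes u: "dominated u"
  shows "continuous_on (Z \<times> A) (nearby_Q n u)"
proof -
  have "continuous_on ((Z \<times> A) \<times> A) (\<lambda>q. Q u (fst (fst q), snd q))"
    by (rule continuous_on_compose2[OF continuous_on_Q[OF u]]) (auto intro!: continuous_intros)
  then have "continuous_on ((Z \<times> A) \<times> A)
      (\<lambda>q. cutoff n (dist (snd (fst q)) (snd q)) * Q u (fst (fst q), snd q))"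
    unfolding cutoff_def by (intro continuous_intros)
  from continuous_on_SUP_compact[OF this compact_A nonempty_A] show ?thesis
    by (simp add: nearby_Q_def[abs_def])
qed

lemma bdd_below_Q: "dominated u \<Longrightarrow> z \<in> Z \<Longrightarrow> bdd_below ((\<lambda>a. Q u (z, a)) ` A)"
  by (auto intro!: bdd_belowI2[of _ 0] Q_nonneg)

lemma bellman_le: "dominated u \<Longrightarrow> z \<in> Z \<Longrightarrow> a \<in> A \<Longrightarrow> bellman u z \<le> Q u (z, a)"
  unfolding bellman_def by (intro cINF_lower bdd_below_Q)

lemma bellman_attained:
  assumes u: "dominated u" and z: "z \<in> Z"
  shows "\<exists>a\<in>A. bellman u z = Q u (z, a)"
proof -
  have "continuous_on A (\<lambda>a. Q u (z, a))"
    using z by (intro continuous_on_compose2[OF continuous_on_Q[OF u]]) (auto intro!: continuous_intros)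
  from continuous_attains_inf[OF compact_A nonempty_A this]
  obtain a where a: "a \<in> A" "\<And>b. b \<in> A \<Longrightarrow> Q u (z, a) \<le> Q u (z, b)" by auto
  then have "Q u (z, a) \<le> bellman u z"
    unfolding bellman_def by (intro cINF_greatest nonempty_A)
  with a(1) bellman_le[OF u z a(1)] show ?thesis by (auto intro: antisym)
qed

lemma dominated_bellman:
  assumes u: "dominated u"
  shows "dominated (bellman u)"
  unfolding dominated_def
proof (intro conjI ballI)
  show "continuous_on Z (bellman u)"
    unfolding bellman_def[abs_def]
    by (rule continuous_on_INF_compact[OF continuous_on_Q[OF u] compact_A nonempty_A])
  fix z assume z: "z \<in> Z"
  obtain a where a: "a \<in> A" "bellman u z = Q u (z, a)" using bellman_attained[OF u z] by auto
  show "0 \<le> bellman u z" "bellman u z \<le> cost_scale * w z"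
    using Q_nonneg[OF u, of "(z, a)"] Q_le[OF u z a(1)] a z by auto
qed

lemma bdd_below_nearby_Q:
  assumes "dominated u" "z \<in> Z"
  shows "bdd_below ((\<lambda>a. nearby_Q n u (z, a)) ` A)"
proof (rule bdd_belowI2[of _ 0])
  fix a assume a: "a \<in> A"
  have "0 \<le> Q u (z, a)" using assms a by (intro Q_nonneg) auto
  also have "\<dots> \<le> nearby_Q n u (z, a)" using assms a by (intro Q_le_nearby_Q) auto
  finally show "0 \<le> nearby_Q n u (z, a)" .
qed

lemma relaxed_bellman_le:
  "dominated u \<Longrightarrow> z \<in> Z \<Longrightarrow> a \<in> A \<Longrightarrow> relaxed_bellman n u z \<le> nearby_Q n u (z, a)"
  unfolding relaxed_bellman_def by (intro cINF_lower bdd_below_nearby_Q)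

lemma relaxed_bellman_mono:
  assumes "dominated u" "dominated v" "z \<in> Z" "m \<le> n" "\<And>y. y \<in> Z \<Longrightarrow> u y \<le> v y"
  shows "relaxed_bellman n u z \<le> relaxed_bellman m v z"
proof -
  have "relaxed_bellman n u z \<le> nearby_Q m v (z, a)" if "a \<in> A" for a
    using relaxed_bellman_le[OF assms(1,3) that, of n] nearby_Q_mono[OF assms, of a] by simp
  then show ?thesis
    unfolding relaxed_bellman_def[of m] by (intro cINF_greatest nonempty_A)
qed

lemma dominated_relaxed_bellman:
  assumes u: "dominated u"
  shows "dominated (relaxed_bellman n u)"
  unfolding dominated_def
proof (intro conjI ballI)
  show "continuous_on Z (relaxed_bellman n u)"
    unfolding relaxed_bellman_def[abs_def]
    by (rule continuous_on_INF_compact[OF continuous_on_nearby_Q[OF u] compact_A nonempty_A])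
  fix z assume z: "z \<in> Z"
  have "0 \<le> nearby_Q n u (z, a)" if a: "a \<in> A" for a
    using Q_nonneg[OF u, of "(z, a)"] Q_le_nearby_Q[OF u z a, of n a] z a by auto
  then show "0 \<le> relaxed_bellman n u z"
    unfolding relaxed_bellman_def by (intro cINF_greatest nonempty_A)
  obtain a where "a \<in> A" using nonempty_A by auto
  then show "relaxed_bellman n u z \<le> cost_scale * w z"
    using relaxed_bellman_le[OF u z, of a n] nearby_Q_le[OF u z, of n a] by simp
qed

text \<open>Near every action \<open>a\<close> there is a net point \<open>b\<close>, which takes part in the supremum
  \<open>nearby_Q n u (z, a)\<close> with factor 1.\<close>

lemma net_minimizer_le_relaxed_bellman:
  assumes u: "dominated u" and z: "z \<in> Z" and B: "B \<subseteq> A"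
    and net: "\<And>a. a \<in> A \<Longrightarrow> \<exists>b\<in>B. real n * dist a b \<le> 1"
    and min: "\<And>b. b \<in> B \<Longrightarrow> q \<le> Q u (z, b)"
  shows "q \<le> relaxed_bellman n u z"
  unfolding relaxed_bellman_def
proof (rule cINF_greatest[OF nonempty_A])
  fix a assume "a \<in> A"
  then obtain b where "b \<in> B" "real n * dist a b \<le> 1" using net by auto
  then show "q \<le> nearby_Q n u (z, a)"
    using min[of b] Q_le_nearby_Q[OF u z, of b n a] B by auto
qed

section \<open>Bounding value functions by iterates\<close>

definition lower_iterate :: "nat \<Rightarrow> 'z \<Rightarrow> real" where
  "lower_iterate k = (bellman ^^ k) (\<lambda>_. 0)"

definition upper_iterate :: "nat \<Rightarrow> nat \<Rightarrow> 'z \<Rightarrow> real" where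
  "upper_iterate n k = (relaxed_bellman n ^^ k) (\<lambda>z. cost_scale * w z)"

lemma lower_iterate_simps: "lower_iterate 0 = (\<lambda>_. 0)" "lower_iterate (Suc k) = bellman (lower_iterate k)"
  by (simp_all add: lower_iterate_def)

lemma upper_iterate_simps: "upper_iterate n 0 = (\<lambda>z. cost_scale * w z)" "upper_iterate n (Suc k) = relaxed_bellman n (upper_iterate n k)"
  by (simp_all add: upper_iterate_def)

lemma dominated_lower_iterate: "dominated (lower_iterate k)"
  by (induction k) (auto simp: lower_iterate_simps dominated_zero dominated_bellman)

lemma dominated_upper_iterate: "dominated (upper_iterate n k)"
  by (induction k) (auto simp: upper_iterate_simps dominated_cost_scale_w dominated_relaxed_bellman)

lemma upper_iterate_antimono:
  assumes "m \<le> n" "z \<in> Z"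
  shows "upper_iterate n k z \<le> upper_iterate m k z"
  using assms(2)
proof (induction k arbitrary: z)
  case (Suc k)
  then show ?case
    unfolding upper_iterate_simps by (intro relaxed_bellman_mono dominated_upper_iterate assms(1)) auto
qed (simp add: upper_iterate_simps)

text \<open>With \<open>k - t\<close> steps to go at time \<open>t\<close>, the iterates satisfy the hypothesis of
  \<open>le_value_function\<close>. Fewer actions make the infimum over actions larger, so \<open>B\<close> may be any
  subset of \<open>A\<close>.\<close>

lemma lower_iterate_le_value_function:
  assumes B: "B \<subseteq> A" "B \<in> sets borel" and z: "z \<in> Z"
  shows "ennreal (lower_iterate k z) \<le> value_function Z B \<eta> c \<beta> z"
proof -
  interpret B: mdp Z B \<eta> c \<beta> by (rule mdp_subset[OF B])
  have "ennreal (lower_iterate (k - 0) z) \<le> value_function Z B \<eta> c \<beta> z"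
  proof (rule B.le_value_function[OF z, where h = "\<lambda>t y. ennreal (lower_iterate (k - t) y)" and N = k])
    show "(\<lambda>y. ennreal (lower_iterate (k - t) y)) \<in> borel_measurable (borel_on Z)" for t
      using dominated_measurable[OF dominated_lower_iterate] by simp
    show "ennreal (lower_iterate (k - k) y) = 0" for y by (simp add: lower_iterate_simps)
    fix t y a assume y: "y \<in> Z" and "a \<in> B"
    then have a: "a \<in> A" using B by auto
    show "ennreal (lower_iterate (k - t) y) \<le>
        ennreal (c (y, a)) + ennreal \<beta> * (\<integral>\<^sup>+ x. ennreal (lower_iterate (k - Suc t) x) \<partial>\<eta> (y, a))"
    proof (cases "t < k")
      case True
      then have "k - t = Suc (k - Suc t)" by simp
      then have "lower_iterate (k - t) y \<le> Q (lower_iterate (k - Suc t)) (y, a)"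
        using bellman_le[OF dominated_lower_iterate y a] by (simp add: lower_iterate_simps)
      then show ?thesis
        using y a by (subst ennreal_Q[OF dominated_lower_iterate]) (auto intro: ennreal_leI)
    qed (simp add: lower_iterate_simps)
  qed
  then show ?thesis by simp
qed

text \<open>The selectors take values in the net \<open>B\<close> and hence serve every action set \<open>A'\<close> between \<open>B\<close>
  and \<open>A\<close>; the cases \<open>A' = B\<close> and \<open>A' = A\<close> are the quantized and the original model.\<close>

lemma value_function_le_upper_iterate:
  assumes B: "finite B" "B \<noteq> {}" "B \<subseteq> A'" and A': "A' \<subseteq> A" "A' \<in> sets borel"
    and net: "\<And>a. a \<in> A \<Longrightarrow> \<exists>b\<in>B. real n * dist a b \<le> 1" and z: "z \<in> Z"
  shows "value_function Z A' \<eta> c \<beta> z \<le> ennreal (upper_iterate n k z)"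
proof -
  interpret A': mdp Z A' \<eta> c \<beta> by (rule mdp_subset[OF A'])
  have "\<forall>j. \<exists>f. f \<in> borel_on Z \<rightarrow>\<^sub>M borel_on A' \<and>
      (\<lambda>y. Q (upper_iterate n j) (y, f y)) \<in> borel_measurable (borel_on Z) \<and>
      (\<forall>y. f y \<in> B \<and> (\<forall>b\<in>B. Q (upper_iterate n j) (y, f y) \<le> Q (upper_iterate n j) (y, b)))"
  proof (intro allI finite_measurable_argmin[OF B(1,2)])
    show "B \<subseteq> space (borel_on A')" using B by (simp add: space_restrict_space)
    fix j b assume "b \<in> B"
    then have "continuous_on Z (\<lambda>y. Q (upper_iterate n j) (y, b))"
      using B A' by (intro continuous_on_compose2[OF continuous_on_Q[OF dominated_upper_iterate]])
        (auto intro!: continuous_intros)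
    then show "(\<lambda>y. Q (upper_iterate n j) (y, b)) \<in> borel_measurable (borel_on Z)"
      by (rule borel_measurable_continuous_on_restrict)
  qed
  from choice[OF this] obtain f where f: "\<And>j. f j \<in> borel_on Z \<rightarrow>\<^sub>M borel_on A'" "\<And>j y. f j y \<in> B"
    "\<And>j y b. b \<in> B \<Longrightarrow> Q (upper_iterate n j) (y, f j y) \<le> Q (upper_iterate n j) (y, b)"
    by blast
  have fA: "f j y \<in> A" for j y using f(2) B A' by blast
  have "value_function Z A' \<eta> c \<beta> z \<le> ennreal (upper_iterate n (k - 0) z)"
  proof (rule A'.value_function_le[OF z, where h = "\<lambda>t y. ennreal (upper_iterate n (k - t) y)"
        and f = "\<lambda>t. f (k - Suc t)"])
    show "(\<lambda>y. ennreal (upper_iterate n (k - t) y)) \<in> borel_measurable (borel_on Z)" for t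
      using dominated_measurable[OF dominated_upper_iterate] by simp
    show "f (k - Suc t) \<in> borel_on Z \<rightarrow>\<^sub>M borel_on A'" for t by (rule f(1))
    fix t y assume y: "y \<in> Z"
    have "Q (upper_iterate n (k - Suc t)) (y, f (k - Suc t) y) \<le> upper_iterate n (k - t) y"
    proof (cases "t < k")
      case True
      then have "k - t = Suc (k - Suc t)" by simp
      then show ?thesis
        using net_minimizer_le_relaxed_bellman[OF dominated_upper_iterate y _ net f(3)] B A'
        by (simp add: upper_iterate_simps)
    next
      case False
      \<comment> \<open>Past time \<open>k\<close> the truncated difference \<open>k - t\<close> stays 0, and \<open>C * w\<close> is its own upper bound
        whatever is played.\<close>
      then show ?thesis using Q_le[OF dominated_cost_scale_w y fA] by (simp add: upper_iterate_simps)
    qed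
    then show "ennreal (c (y, f (k - Suc t) y)) +
        ennreal \<beta> * (\<integral>\<^sup>+ x. ennreal (upper_iterate n (k - Suc t) x) \<partial>\<eta> (y, f (k - Suc t) y))
        \<le> ennreal (upper_iterate n (k - t) y)"
      using y fA by (subst ennreal_Q[OF dominated_upper_iterate]) (auto intro: ennreal_leI)
  qed
  then show ?thesis by simp
qed

section \<open>Convergence of the iterates\<close>

text \<open>In the induction step let \<open>a\<close> be optimal for \<open>lower_iterate k\<close> at \<open>z\<close>. The induction hypothesis
  passes to \<open>Q\<close> at \<open>(z, a)\<close> by dominated convergence, at the price of a factor \<open>\<alpha> * \<beta>\<close>. For a
  fixed index \<open>N\<close> the function \<open>Q (upper_iterate N k) (z, \<cdot>)\<close> is continuous at \<open>a\<close>, and it bounds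
  those of all larger indices; so the supremum over actions near \<open>a\<close> is harmless once the cutoff is
  narrow enough.\<close>

lemma upper_iterate_near_lower_iterate:
  assumes "z \<in> Z" "0 < e"
  shows "\<exists>n. upper_iterate n k z < lower_iterate k z + cost_scale * (\<alpha> * \<beta>) ^ k * w z + e"
  using assms
proof (induction k arbitrary: z e)
  case 0
  then show ?case by (simp add: upper_iterate_simps lower_iterate_simps)
next
  case (Suc k)
  note z = Suc.prems(1) and e = Suc.prems(2)
  define d where "d = cost_scale * (\<alpha> * \<beta>) ^ k"
  have d: "0 \<le> d" using cost_scale_nonneg \<alpha>\<beta>_bounds by (simp add: d_def)
  obtain a where a: "a \<in> A" "bellman (lower_iterate k) z = Q (lower_iterate k) (z, a)"
    using bellman_attained[OF dominated_lower_iterate z] by auto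
  have p: "(z, a) \<in> Z \<times> A" using z a by simp
  \<comment> \<open>The part of \<open>upper_iterate n k\<close> above its asymptotic bound; it is dominated by \<open>C * w\<close> and
    tends to 0 pointwise, so that its integral tends to 0.\<close>
  define g where "g n y = max 0 (upper_iterate n k y - lower_iterate k y - d * w y)" for n y
  have g_le: "0 \<le> g n y" "g n y \<le> cost_scale * w y" if "y \<in> Z" for n y
    using dominatedD(2)[OF dominated_lower_iterate that, of k] dominatedD(3)[OF dominated_upper_iterate that, of n k]
      mult_nonneg_nonneg[OF d w_nonneg[OF that]]
      mult_nonneg_nonneg[OF cost_scale_nonneg w_nonneg[OF that]]
    by (auto simp: g_def)
  have g: "dominated (g n)" for n
    unfolding dominated_def
  proof (intro conjI ballI)
    show "continuous_on Z (g n)"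
      unfolding g_def[abs_def]
      using dominatedD(1)[OF dominated_lower_iterate] dominatedD(1)[OF dominated_upper_iterate] w_continuous
      by (intro continuous_intros)
  qed (use g_le in auto)
  have g_lim: "(\<lambda>n. g n y) \<longlonglongrightarrow> 0" if y: "y \<in> Z" for y
  proof (rule order_tendstoI)
    fix b :: real assume "b < 0"
    then show "\<forall>\<^sub>F n in sequentially. b < g n y"
      by (intro always_eventually allI less_le_trans[OF _ g_le(1)[OF y]])
  next
    fix b :: real assume b: "0 < b"
    obtain N where N: "upper_iterate N k y < lower_iterate k y + d * w y + b"
      using Suc.IH[OF y b] by (auto simp: d_def)
    show "\<forall>\<^sub>F n in sequentially. g n y < b"
      using N b upper_iterate_antimono[OF _ y, of N _ k]
      by (intro eventually_sequentiallyI[of N]) (fastforce simp: g_def)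
  qed
  have "(\<lambda>n. mean (g n) (z, a)) \<longlonglongrightarrow> (\<integral>y. 0 \<partial>\<eta> (z, a))"
    unfolding mean_def
  proof (rule integral_dominated_convergence[where w = "\<lambda>y. cost_scale * w y"])
    show "g n \<in> borel_measurable (\<eta> (z, a))" for n
      by (rule continuous_on_measurable_kernel[OF dominatedD(1)[OF g] p])
    show "integrable (\<eta> (z, a)) (\<lambda>y. cost_scale * w y)" using integrable_w[OF p] by simp
    show "AE y in \<eta> (z, a). (\<lambda>n. g n y) \<longlonglongrightarrow> 0"
      using g_lim kernel_space(3)[OF p] by (intro AE_I2) auto
    show "AE y in \<eta> (z, a). norm (g n y) \<le> cost_scale * w y" for n
      using g_le kernel_space(3)[OF p] by (intro AE_I2) auto
  qed simp
  then have "(\<lambda>n. \<beta> * mean (g n) (z, a)) \<longlonglongrightarrow> 0"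
    by (simp add: tendsto_mult_right_zero)
  from order_tendstoD(2)[OF this, of "e / 2"] e
  obtain N where N: "\<beta> * mean (g N) (z, a) < e / 2"
    by (auto simp: eventually_sequentially)
  have near: "Q (upper_iterate N k) (z, a) < Q (lower_iterate k) (z, a) + \<alpha> * \<beta> * d * w z + e / 2"
  proof -
    have "mean (upper_iterate N k) (z, a) \<le> (\<integral>y. lower_iterate k y + d * w y + g N y \<partial>\<eta> (z, a))"
      unfolding mean_def
      using integrable_dominated[OF dominated_upper_iterate p] integrable_dominated[OF dominated_lower_iterate p]
        integrable_dominated[OF g p] integrable_w[OF p]
      by (intro integral_mono) (auto simp: g_def)
    also have "\<dots> = mean (lower_iterate k) (z, a) + d * mean w (z, a) + mean (g N) (z, a)"
      unfolding mean_def
      using integrable_dominated[OF dominated_lower_iterate p] integrable_dominated[OF g p] integrable_w[OF p]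
      by simp
    also have "\<dots> \<le> mean (lower_iterate k) (z, a) + d * (\<alpha> * w z) + mean (g N) (z, a)"
      using mult_left_mono[OF mean_w_le[OF z a(1)] d] by simp
    finally have "\<beta> * mean (upper_iterate N k) (z, a) \<le>
        \<beta> * (mean (lower_iterate k) (z, a) + d * (\<alpha> * w z) + mean (g N) (z, a))"
      using discount by simp
    then show ?thesis using N by (simp add: Q_def algebra_simps)
  qed
  have "continuous_on A (\<lambda>b. Q (upper_iterate N k) (z, b))"
    using z by (intro continuous_on_compose2[OF continuous_on_Q[OF dominated_upper_iterate]])
      (auto intro!: continuous_intros)
  then obtain \<delta> where \<delta>: "0 < \<delta>"
    "\<And>b. b \<in> A \<Longrightarrow> dist b a < \<delta> \<Longrightarrow> dist (Q (upper_iterate N k) (z, b)) (Q (upper_iterate N k) (z, a)) < e / 4"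
    using a(1) e unfolding continuous_on_iff by (metis divide_pos_pos zero_less_numeral)
  obtain n0 :: nat where n0: "2 < real n0 * \<delta>"
    using reals_Archimedean3[OF \<delta>(1)] by blast
  define n where "n = max N n0"
  have n: "N \<le> n" "2 \<le> real n * \<delta>"
  proof -
    show "N \<le> n" by (simp add: n_def)
    have "real n0 * \<delta> \<le> real n * \<delta>"
      using \<delta>(1) by (intro mult_right_mono) (auto simp: n_def)
    then show "2 \<le> real n * \<delta>" using n0 by linarith
  qed
  have "nearby_Q n (upper_iterate n k) (z, a) \<le> Q (upper_iterate N k) (z, a) + e / 4"
    unfolding nearby_Q_def fst_conv snd_conv
  proof (rule cSUP_least[OF nonempty_A])
    fix b assume b: "b \<in> A"
    have q: "Q (upper_iterate n k) (z, b) \<le> Q (upper_iterate N k) (z, b)"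
      using z b n(1) by (intro Q_mono dominated_upper_iterate upper_iterate_antimono) auto
    show "cutoff n (dist a b) * Q (upper_iterate n k) (z, b) \<le> Q (upper_iterate N k) (z, a) + e / 4"
    proof (cases "dist b a < \<delta>")
      case True
      then show ?thesis
        using q cutoff_Q_le[OF dominated_upper_iterate z b, of n "dist a b" n k] \<delta>(2)[OF b True]
        unfolding dist_real_def by linarith
    next
      case False
      then have "2 \<le> real n * dist a b"
        using n(2) mult_left_mono[of \<delta> "dist a b" "real n"] by (simp add: dist_commute)
      then show ?thesis
        using Q_nonneg[OF dominated_upper_iterate p, of N k] e by (simp add: cutoff_eq_0)
    qed
  qed
  then have "upper_iterate n (Suc k) z \<le> Q (upper_iterate N k) (z, a) + e / 4"
    using relaxed_bellman_le[OF dominated_upper_iterate z a(1), of n n k] by (simp add: upper_iterate_simps)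
  then have "upper_iterate n (Suc k) z < lower_iterate (Suc k) z + cost_scale * (\<alpha> * \<beta>) ^ Suc k * w z + e"
    using near a(2) e by (simp add: lower_iterate_simps d_def algebra_simps)
  then show ?case by blast
qed

text \<open>First \<open>k\<close> is chosen to make \<open>C * (\<alpha> * \<beta>)^k * w\<close> small on \<open>K\<close>; for this \<open>k\<close> the functions
  decrease in \<open>n\<close> and the pointwise estimate becomes uniform.\<close>

lemma upper_iterate_uniformly_near_lower_iterate:
  assumes K: "compact K" "K \<subseteq> Z" and e: "0 < e"
  shows "\<exists>k N. \<forall>n\<ge>N. \<forall>z\<in>K. upper_iterate n k z \<le> lower_iterate k z + e"
proof -
  have "bounded (w ` K)"
    by (intro compact_imp_bounded compact_continuous_image K(1) continuous_on_subset[OF w_continuous K(2)])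
  then obtain W where W: "0 < W" "\<And>z. z \<in> K \<Longrightarrow> w z \<le> W"
    unfolding bounded_pos by (auto intro: order_trans[OF abs_ge_self])
  have "(\<lambda>k. cost_scale * (\<alpha> * \<beta>) ^ k * W) \<longlonglongrightarrow> cost_scale * 0 * W"
    using \<alpha>\<beta>_bounds by (intro tendsto_intros LIMSEQ_realpow_zero) auto
  from order_tendstoD(2)[OF this, of "e / 2"] e
  obtain k where k: "cost_scale * (\<alpha> * \<beta>) ^ k * W < e / 2"
    by (auto simp: eventually_sequentially)
  define D where "D n z = upper_iterate n k z - lower_iterate k z - cost_scale * (\<alpha> * \<beta>) ^ k * w z" for n z
  have "\<exists>N. \<forall>n\<ge>N. \<forall>z\<in>K. D n z < e / 2"
  proof (rule compact_decreasing_uniform_less[OF K(1)])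
    show "continuous_on K (D n)" for n
      unfolding D_def[abs_def]
      using K(2) dominatedD(1)[OF dominated_lower_iterate] dominatedD(1)[OF dominated_upper_iterate] w_continuous
      by (intro continuous_intros) (blast intro: continuous_on_subset)+
    show "D n z \<le> D m z" if "m \<le> n" "z \<in> K" for m n z
      using upper_iterate_antimono[OF that(1), of z k] that(2) K(2) by (auto simp: D_def)
    show "\<exists>n. D n z < e / 2" if z: "z \<in> K" for z
    proof -
      obtain n where "upper_iterate n k z < lower_iterate k z + cost_scale * (\<alpha> * \<beta>) ^ k * w z + e / 2"
        using upper_iterate_near_lower_iterate[of z "e / 2" k] z K(2) e by auto
      then show ?thesis by (intro exI[of _ n]) (simp add: D_def)
    qed
  qed
  then obtain N where N: "\<And>n z. n \<ge> N \<Longrightarrow> z \<in> K \<Longrightarrow> D n z < e / 2" by blast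
  have "upper_iterate n k z \<le> lower_iterate k z + e" if "n \<ge> N" "z \<in> K" for n z
  proof -
    have "cost_scale * (\<alpha> * \<beta>) ^ k * w z \<le> cost_scale * (\<alpha> * \<beta>) ^ k * W"
      using W(2)[OF that(2)] cost_scale_nonneg \<alpha>\<beta>_bounds by (intro mult_left_mono) auto
    then show ?thesis using N[OF that] k by (simp add: D_def)
  qed
  then show ?thesis by blast
qed

end

section \<open>Convergence of the value functions\<close>

lemma abs_diff_le:
  assumes "ennreal l \<le> x" "x \<le> ennreal u" "ennreal l \<le> y" "y \<le> ennreal u" "0 \<le> l" "u \<le> l + e"
  shows "abs_diff x y \<le> ennreal e"
proof -
  obtain r s where "x = ennreal r" "0 \<le> r" "y = ennreal s" "0 \<le> s"
    using assms(2,4) by (cases x; cases y) (auto simp: top_unique)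
  with assms show ?thesis
    by (auto simp: abs_diff_ennreal ennreal_le_iff2 intro!: ennreal_leI)
qed

lemma ennreal_tendsto_0I:
  fixes f :: "nat \<Rightarrow> ennreal"
  assumes "\<And>e. 0 < e \<Longrightarrow> \<forall>\<^sub>F n in sequentially. f n \<le> ennreal e"
  shows "f \<longlonglongrightarrow> 0"
proof (rule order_tendstoI)
  fix b :: ennreal assume "0 < b"
  then obtain r where r: "0 < r" "r < b" using dense by blast
  then obtain e where e: "r = ennreal e" "0 \<le> e" by (cases r) auto
  with r(1) have "0 < e" by (simp add: ennreal_less_zero_iff)
  from assms[OF this] show "\<forall>\<^sub>F n in sequentially. f n < b"
    by eventually_elim (use r(2) e(1) in auto)
qed simp

theorem theorem3p2:
  fixes Z :: "'z::polish_space set" and A :: "'a::polish_space set"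
    and \<eta> :: "'z \<times> 'a \<Rightarrow> 'z measure" and c :: "'z \<times> 'a \<Rightarrow> real"
    and \<beta> M \<alpha> :: real and w :: "'z \<Rightarrow> real" and \<Lambda> :: "nat \<Rightarrow> 'a set"
  assumes model: "mdp Z A \<eta> c \<beta>"
    and cost_continuous: "continuous_on (Z \<times> A) c"
    and kernel_continuous: "weakly_continuous_kernel Z A \<eta>"
    and compact_A: "compact A"
    and M_nonneg: "0 \<le> M"
    and \<alpha>_bounds: "1 \<le> \<alpha>" "\<alpha> < 1 / \<beta>"
    and w_continuous: "continuous_on Z w"
    and w_ge_1: "\<And>z. z \<in> Z \<Longrightarrow> 1 \<le> w z"
    and cost_bound: "\<And>z. z \<in> Z \<Longrightarrow> (SUP a\<in>A. ennreal (c (z, a))) \<le> ennreal (M * w z)"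
    and w_bound: "\<And>z. z \<in> Z \<Longrightarrow>
      (SUP a\<in>A. \<integral>\<^sup>+ y. ennreal (w y) \<partial>\<eta> (z, a)) \<le> ennreal (\<alpha> * w z)"
    and w_integral_continuous:
      "continuous_on (Z \<times> A) (\<lambda>p. \<integral>\<^sup>+ y. ennreal (w y) \<partial>\<eta> p)"
    and net_finite: "\<And>n. 1 \<le> n \<Longrightarrow> finite (\<Lambda> n) \<and> \<Lambda> n \<noteq> {} \<and> \<Lambda> n \<subseteq> A"
    and net_dense: "\<And>n a. 1 \<le> n \<Longrightarrow> a \<in> A \<Longrightarrow> Min ((\<lambda>b. dist a b) ` \<Lambda> n) < 1 / real n"
  shows "(\<forall>K. compact K \<and> K \<subseteq> Z \<longrightarrow>
            (\<lambda>n. SUP z\<in>K. abs_diff (value_function Z (\<Lambda> n) \<eta> c \<beta> z)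
                                  (value_function Z A \<eta> c \<beta> z)) \<longlonglongrightarrow> 0) \<and>
         (\<forall>z\<in>Z. (\<lambda>n. abs_diff (value_function Z (\<Lambda> n) \<eta> c \<beta> z)
                               (value_function Z A \<eta> c \<beta> z)) \<longlonglongrightarrow> 0)"
proof -
  interpret mdp Z A \<eta> c \<beta> by (rule model)
  interpret weighted_mdp Z A \<eta> c \<beta> M \<alpha> w
  proof unfold_locales
    show "A \<noteq> {}" using net_finite[of 1] by auto
    show "c (z, a) \<le> M * w z" if "z \<in> Z" "a \<in> A" for z a
    proof -
      have "ennreal (c (z, a)) \<le> ennreal (M * w z)"
        using SUP_upper[OF that(2), of "\<lambda>a. ennreal (c (z, a))"] cost_bound[OF that(1)] by (rule order_trans)
      moreover have "0 \<le> M * w z" using M_nonneg w_ge_1[OF that(1)] by simp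
      ultimately show ?thesis by (simp add: ennreal_le_iff)
    qed
    show "(\<integral>\<^sup>+ y. ennreal (w y) \<partial>\<eta> (z, a)) \<le> ennreal (\<alpha> * w z)" if "z \<in> Z" "a \<in> A" for z a
      using SUP_upper[OF that(2), of "\<lambda>a. \<integral>\<^sup>+ y. ennreal (w y) \<partial>\<eta> (z, a)"] w_bound[OF that(1)]
      by (rule order_trans)
  qed fact+
  have net: "\<exists>b\<in>\<Lambda> n. real n * dist a b \<le> 1" if n: "1 \<le> n" and a: "a \<in> A" for n a
  proof -
    have "Min ((\<lambda>b. dist a b) ` \<Lambda> n) \<in> (\<lambda>b. dist a b) ` \<Lambda> n"
      using net_finite[OF n] by (intro Min_in) auto
    then obtain b where "b \<in> \<Lambda> n" "dist a b < 1 / real n"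
      using net_dense[OF n a] by auto
    then show ?thesis using n by (intro bexI[of _ b]) (auto simp: field_simps)
  qed
  have main: "\<forall>\<^sub>F n in sequentially. \<forall>z\<in>K. abs_diff (value_function Z (\<Lambda> n) \<eta> c \<beta> z)
      (value_function Z A \<eta> c \<beta> z) \<le> ennreal e"
    if K: "compact K" "K \<subseteq> Z" and e: "0 < e" for K e
  proof -
    obtain k N where N: "\<And>n z. n \<ge> N \<Longrightarrow> z \<in> K \<Longrightarrow> upper_iterate n k z \<le> lower_iterate k z + e"
      using upper_iterate_uniformly_near_lower_iterate[OF K e] by blast
    show ?thesis
    proof (rule eventually_sequentiallyI[of "max 1 N"], rule ballI)
      fix n z assume "max 1 N \<le> n" and z: "z \<in> K"
      then have n: "1 \<le> n" "N \<le> n" by auto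
      have zZ: "z \<in> Z" using z K by auto
      have L: "finite (\<Lambda> n)" "\<Lambda> n \<noteq> {}" "\<Lambda> n \<subseteq> A" using net_finite[OF n(1)] by auto
      have Lb: "\<Lambda> n \<in> sets borel" using L(1) by (simp add: finite_imp_closed borel_closed)
      show "abs_diff (value_function Z (\<Lambda> n) \<eta> c \<beta> z) (value_function Z A \<eta> c \<beta> z) \<le> ennreal e"
        by (rule abs_diff_le[OF lower_iterate_le_value_function[OF L(3) Lb zZ]
              value_function_le_upper_iterate[OF L(1,2) subset_refl L(3) Lb net[OF n(1)] zZ]
              lower_iterate_le_value_function[OF subset_refl borel_A zZ]
              value_function_le_upper_iterate[OF L subset_refl borel_A net[OF n(1)] zZ]
              dominatedD(2)[OF dominated_lower_iterate zZ] N[OF n(2) z]])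
    qed
  qed
  show ?thesis
  proof (intro conjI allI impI ballI)
    fix K assume K: "compact K \<and> K \<subseteq> Z"
    show "(\<lambda>n. SUP z\<in>K. abs_diff (value_function Z (\<Lambda> n) \<eta> c \<beta> z)
        (value_function Z A \<eta> c \<beta> z)) \<longlonglongrightarrow> 0"
    proof (rule ennreal_tendsto_0I)
      fix e :: real assume "0 < e"
      with K have "\<forall>\<^sub>F n in sequentially. \<forall>z\<in>K. abs_diff (value_function Z (\<Lambda> n) \<eta> c \<beta> z)
          (value_function Z A \<eta> c \<beta> z) \<le> ennreal e"
        by (intro main) auto
      then show "\<forall>\<^sub>F n in sequentially. (SUP z\<in>K. abs_diff (value_function Z (\<Lambda> n) \<eta> c \<beta> z)
          (value_function Z A \<eta> c \<beta> z)) \<le> ennreal e"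
        by eventually_elim (auto intro: SUP_least)
    qed
  next
    fix z assume "z \<in> Z"
    then show "(\<lambda>n. abs_diff (value_function Z (\<Lambda> n) \<eta> c \<beta> z)
        (value_function Z A \<eta> c \<beta> z)) \<longlonglongrightarrow> 0"
      using main[of "{z}"] by (intro ennreal_tendsto_0I) auto
  qed
qed

end
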